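(* Let $K$ be a field. For every finite-dimensional chain complex $C_\ast$ of $K$-vector spaces, choose a sequence of algebraic Morse theory reductions, each relative to a nonempty Morse matching, that ends in a complex $C'_\ast$ whose boundary maps are all zero, and let $f^C_\ast: C'_\ast\to C_\ast$ and $g^C_\ast: C_\ast\to C'_\ast$ be the resulting composite homotopy equivalences. For a chain map $\varphi_\ast: C_\ast\to D_\ast$ put $\varphi'_\ast=g^D_\ast\circ\varphi_\ast\circ f^C_\ast: C'_\ast\to D'_\ast$. Then the rule $C_\ast\mapsto C'_\ast$, $\varphi_\ast\mapsto\varphi'_\ast$ is (up to natural isomorphism) the homology functor from the category of finite-dimensional chain complexes of $K$-vector spaces to the category of $\mathbb{Z}$-graded $K$-vector spaces. That is, $\mathrm{id}_{C_\ast}'=\mathrm{id}_{C'_\ast}$ and $(\psi\circ\varphi)'=\psi'\circ\varphi'$ for all composable chain maps, and the functor so obtained is naturally isomorphic to $H_\ast$.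
   Context: Chain complexes are of the form $C_0\xleftarrow{\partial_1}C_1\leftarrow\cdots\xleftarrow{\partial_N}C_N$ (for some $N$), with all $C_k$ finite-dimensional and $\partial_k\partial_{k+1}=0$. Graph of a complex. Pick a basis $I_k$ of each $C_k$. The digraph $\Gamma_{C_\ast}$ has vertex set the disjoint union $\bigsqcup_k I_k$, and for each nonzero entry $\partial_{k,u,v}=w$ of the matrix of $\partial_k$ (row $u\in I_{k-1}$, column $v\in I_k$) a directed edge from $v$ to $u$ of weight $w$, written $u\xleftarrow{w}v$. Morse matching. A set $\mathcal{M}$ of edges of $\Gamma_{C_\ast}$ is a Morse matching if: (1) distinct edges in $\mathcal{M}$ have no common vertex; (2) the weight of each edge in $\mathcal{M}$ is invertible; (3) the digraph $\Gamma^{\mathcal{M}}_{C_\ast}$, obtained from $\Gamma_{C_\ast}$ by replacing each edge $u\xleftarrow{w}v$ in $\mathcal{M}$ by the reversed edge $u\to v$ with weight $-1/w$, contains no directed cycles (and no infinite paths $u_1\to v_1\to u_2\to v_2\to\cdots$ with all $u_i$ in one $I_k$, which is automatic here by finiteness). Reduction. Let $I'_k\subseteq I_k$ be the set of critical vertices, i.e. those not incident to any edge of $\mathcal{M}$, and let $C'_k$ be the vector space with basis $I'_k$. For vertices $v,u$ let $\Gamma_{v,u}$ be the set of directed paths from $v$ to $u$ in $\Gamma^{\mathcal{M}}_{C_\ast}$ (including the path of length $0$ if $u=v$), and for $\gamma\in\Gamma_{v,u}$ let $\partial_\gamma(v)$ be $u$ multiplied by the product of the weights of the edges of $\gamma$.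 Define, for $v'\in I'_k$ and $v\in I_k$, $$\partial'_k(v')=\sum_{u'\in I'_{k-1},\,\gamma\in\Gamma_{v',u'}}\partial_\gamma(v'),\quad f_k(v')=\sum_{u\in I_k,\,\gamma\in\Gamma_{v',u}}\partial_\gamma(v'),\quad g_k(v)=\sum_{u'\in I'_k,\,\gamma\in\Gamma_{v,u'}}\partial_\gamma(v).$$ It is known that $(C'_\ast,\partial'_\ast)$ is a chain complex and that $f_\ast:C'_\ast\to C_\ast$ and $g_\ast:C_\ast\to C'_\ast$ are mutually inverse homotopy equivalences of chain complexes. Passing from $C_\ast$ to $C'_\ast$ is one reduction step. Iteration. Over a field, as long as some boundary matrix is nonzero a nonempty Morse matching exists. Repeated steps $C_\ast\rightsquigarrow C^{(1)}_\ast\rightsquigarrow\cdots\rightsquigarrow C^{(r)}_\ast$ with maps $f^{(i)}_\ast:C^{(i)}_\ast\to C^{(i-1)}_\ast$ and $g^{(i)}_\ast:C^{(i-1)}_\ast\to C^{(i)}_\ast$ (where $C^{(0)}_\ast=C_\ast$) are carried out until all boundaries of $C^{(r)}_\ast$ are zero. The complex denoted $C'_\ast$ in the claim is this final $C^{(r)}_\ast$, regarded as a graded vector space, and the composites are $f^C_\ast=f^{(1)}_\ast\circ\cdots\circ f^{(r)}_\ast$ and $g^C_\ast=g^{(r)}_\ast\circ\cdots\circ g^{(1)}_\ast$ (identity maps if $r=0$). *)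

theory Defs
  imports "Jordan_Normal_Form.VS_Connect" "Graph_Theory.Graph_Theory" "HOL-Algebra.AbelCoset"
begin

text \<open>
  The ground field is a type \<open>'k\<close> of class \<open>field\<close>, viewed as the ring \<open>class_ring\<close>; vector spaces
  are modules (in the sense of HOL-Algebra) over it, with carriers in an arbitrary type \<open>'v\<close>.
\<close>

section \<open>Chain complexes, graded spaces and homology\<close>

text \<open>
  Complexes are indexed by the integers, a complex $C_0 \leftarrow \cdots \leftarrow C_N$ being
  extended by zero spaces.  The differential \<open>bdry C k\<close> maps degree \<open>k\<close> to degree \<open>k - 1\<close>.
\<close>

record ('k, 'v) chain_complex =
  chain_space :: "int \<Rightarrow> ('k, 'v) module"
  bdry :: "int \<Rightarrow> 'v \<Rightarrow> 'v"

definition fd_chain_complex :: "('k::field, 'v) chain_complex \<Rightarrow> bool" where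
  "fd_chain_complex C \<longleftrightarrow>
     (\<forall>k. vectorspace class_ring (chain_space C k) \<and> vectorspace.fin_dim class_ring (chain_space C k)) \<and>
     (\<exists>N::nat. \<forall>k. k < 0 \<or> k > int N \<longrightarrow> carrier (chain_space C k) = {\<zero>\<^bsub>chain_space C k\<^esub>}) \<and>
     (\<forall>k. linear_map class_ring (chain_space C k) (chain_space C (k - 1)) (bdry C k)) \<and>
     (\<forall>k. \<forall>x\<in>carrier (chain_space C (k + 1)). bdry C k (bdry C (k + 1) x) = \<zero>\<^bsub>chain_space C (k - 1)\<^esub>)"

definition zero_boundaries :: "('k, 'v) chain_complex \<Rightarrow> bool" where
  "zero_boundaries C \<longleftrightarrow>
     (\<forall>k. \<forall>x\<in>carrier (chain_space C k). bdry C k x = \<zero>\<^bsub>chain_space C (k - 1)\<^esub>)"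

definition graded_space :: "(int \<Rightarrow> ('k::field, 'v) module) \<Rightarrow> bool" where
  "graded_space V \<longleftrightarrow> (\<forall>k. vectorspace class_ring (V k))"

definition graded_map ::
    "(int \<Rightarrow> ('k::field, 'v) module) \<Rightarrow> (int \<Rightarrow> ('k, 'w) module) \<Rightarrow> (int \<Rightarrow> 'v \<Rightarrow> 'w) \<Rightarrow> bool" where
  "graded_map V W \<phi> \<longleftrightarrow> (\<forall>k. linear_map class_ring (V k) (W k) (\<phi> k))"

definition graded_iso ::
    "(int \<Rightarrow> ('k::field, 'v) module) \<Rightarrow> (int \<Rightarrow> ('k, 'w) module) \<Rightarrow> (int \<Rightarrow> 'v \<Rightarrow> 'w) \<Rightarrow> bool" where
  "graded_iso V W \<phi> \<longleftrightarrow>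
     graded_map V W \<phi> \<and> (\<forall>k. bij_betw (\<phi> k) (carrier (V k)) (carrier (W k)))"

text \<open>
  Maps are total functions on the underlying types; as morphisms with source \<open>V\<close> they are equal
  when they agree on the carriers of \<open>V\<close>.
\<close>

definition graded_eq ::
    "(int \<Rightarrow> ('k, 'v) module) \<Rightarrow> (int \<Rightarrow> 'v \<Rightarrow> 'w) \<Rightarrow> (int \<Rightarrow> 'v \<Rightarrow> 'w) \<Rightarrow> bool" where
  "graded_eq V \<phi> \<psi> \<longleftrightarrow> (\<forall>k. \<forall>x\<in>carrier (V k). \<phi> k x = \<psi> k x)"

definition graded_id :: "int \<Rightarrow> 'v \<Rightarrow> 'v" where
  "graded_id = (\<lambda>k. id)"

definition graded_comp ::
    "(int \<Rightarrow> 'v \<Rightarrow> 'w) \<Rightarrow> (int \<Rightarrow> 'u \<Rightarrow> 'v) \<Rightarrow> int \<Rightarrow> 'u \<Rightarrow> 'w"  (infixl \<open>\<circ>\<^sub>g\<close> 55) where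
  "\<psi> \<circ>\<^sub>g \<phi> = (\<lambda>k. \<psi> k \<circ> \<phi> k)"

definition chain_map ::
    "('k::field, 'v) chain_complex \<Rightarrow> ('k, 'v) chain_complex \<Rightarrow> (int \<Rightarrow> 'v \<Rightarrow> 'v) \<Rightarrow> bool" where
  "chain_map C D \<phi> \<longleftrightarrow>
     graded_map (chain_space C) (chain_space D) \<phi> \<and>
     (\<forall>k. \<forall>x\<in>carrier (chain_space C k). bdry D k (\<phi> k x) = \<phi> (k - 1) (bdry C k x))"

definition quotient_space :: "('k, 'v) module \<Rightarrow> 'v set \<Rightarrow> ('k, 'v set) module" where
  "quotient_space V W =
     \<lparr> carrier = a_rcosets\<^bsub>V\<^esub> W, monoid.mult = undefined, one = undefined,
       zero = W, add = set_add V, smult = (\<lambda>a X. \<Union>x\<in>X. W +>\<^bsub>V\<^esub> (a \<odot>\<^bsub>V\<^esub> x)) \<rparr>"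

definition cycles :: "('k, 'v) chain_complex \<Rightarrow> int \<Rightarrow> 'v set" where
  "cycles C k = {x \<in> carrier (chain_space C k). bdry C k x = \<zero>\<^bsub>chain_space C (k - 1)\<^esub>}"

definition boundaries :: "('k, 'v) chain_complex \<Rightarrow> int \<Rightarrow> 'v set" where
  "boundaries C k = bdry C (k + 1) ` carrier (chain_space C (k + 1))"

definition homology :: "('k, 'v) chain_complex \<Rightarrow> int \<Rightarrow> ('k, 'v set) module" where
  "homology C k = quotient_space ((chain_space C k)\<lparr>carrier := cycles C k\<rparr>) (boundaries C k)"

definition homology_map ::
    "('k, 'v) chain_complex \<Rightarrow> ('k, 'v) chain_complex \<Rightarrow> (int \<Rightarrow> 'v \<Rightarrow> 'v) \<Rightarrow> int \<Rightarrow> 'v set \<Rightarrow> 'v set" where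
  "homology_map C D \<phi> k X = (\<Union>x\<in>X. boundaries D k +>\<^bsub>chain_space D k\<^esub> \<phi> k x)"


section \<open>Functors from complexes to graded spaces\<close>

definition graded_functor ::
    "(('k::field, 'v) chain_complex \<Rightarrow> int \<Rightarrow> ('k, 'w) module) \<Rightarrow>
     (('k, 'v) chain_complex \<Rightarrow> ('k, 'v) chain_complex \<Rightarrow> (int \<Rightarrow> 'v \<Rightarrow> 'v) \<Rightarrow> int \<Rightarrow> 'w \<Rightarrow> 'w) \<Rightarrow> bool" where
  "graded_functor F F\<^sub>m \<longleftrightarrow>
     (\<forall>C. fd_chain_complex C \<longrightarrow> graded_space (F C)) \<and>
     (\<forall>C D \<phi>. fd_chain_complex C \<and> fd_chain_complex D \<and> chain_map C D \<phi> \<longrightarrow>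
        graded_map (F C) (F D) (F\<^sub>m C D \<phi>)) \<and>
     (\<forall>C D \<phi> \<psi>. fd_chain_complex C \<and> fd_chain_complex D \<and> chain_map C D \<phi> \<and> chain_map C D \<psi> \<and>
        graded_eq (chain_space C) \<phi> \<psi> \<longrightarrow> graded_eq (F C) (F\<^sub>m C D \<phi>) (F\<^sub>m C D \<psi>)) \<and>
     (\<forall>C. fd_chain_complex C \<longrightarrow> graded_eq (F C) (F\<^sub>m C C graded_id) graded_id) \<and>
     (\<forall>C D E \<phi> \<psi>. fd_chain_complex C \<and> fd_chain_complex D \<and> fd_chain_complex E \<and>
        chain_map C D \<phi> \<and> chain_map D E \<psi> \<longrightarrow>
        graded_eq (F C) (F\<^sub>m C E (\<psi> \<circ>\<^sub>g \<phi>)) (F\<^sub>m D E \<psi> \<circ>\<^sub>g F\<^sub>m C D \<phi>))"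

text \<open>
  The two functors may have their values in different carrier types: homology
  classes are sets of chains.
\<close>

definition naturally_isomorphic ::
    "(('k::field, 'v) chain_complex \<Rightarrow> int \<Rightarrow> ('k, 'w) module) \<Rightarrow>
     (('k, 'v) chain_complex \<Rightarrow> ('k, 'v) chain_complex \<Rightarrow> (int \<Rightarrow> 'v \<Rightarrow> 'v) \<Rightarrow> int \<Rightarrow> 'w \<Rightarrow> 'w) \<Rightarrow>
     (('k, 'v) chain_complex \<Rightarrow> int \<Rightarrow> ('k, 'u) module) \<Rightarrow>
     (('k, 'v) chain_complex \<Rightarrow> ('k, 'v) chain_complex \<Rightarrow> (int \<Rightarrow> 'v \<Rightarrow> 'v) \<Rightarrow> int \<Rightarrow> 'u \<Rightarrow> 'u) \<Rightarrow> bool" where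
  "naturally_isomorphic F F\<^sub>m G G\<^sub>m \<longleftrightarrow>
     (\<exists>\<theta>. (\<forall>C. fd_chain_complex C \<longrightarrow> graded_iso (F C) (G C) (\<theta> C)) \<and>
          (\<forall>C D \<phi>. fd_chain_complex C \<and> fd_chain_complex D \<and> chain_map C D \<phi> \<longrightarrow>
             graded_eq (F C) (\<theta> D \<circ>\<^sub>g F\<^sub>m C D \<phi>) (G\<^sub>m C D \<phi> \<circ>\<^sub>g \<theta> C)))"


section \<open>Algebraic Morse theory\<close>

definition coord :: "('k::field, 'v) module \<Rightarrow> 'v set \<Rightarrow> 'v \<Rightarrow> 'v \<Rightarrow> 'k" where
  "coord V B x = (THE a. (\<forall>v. v \<notin> B \<longrightarrow> a v = 0) \<and> LinearCombinations.module.lincomb V a B = x)"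

definition bdry_entry ::
    "('k::field, 'v) chain_complex \<Rightarrow> (int \<Rightarrow> 'v set) \<Rightarrow> int \<Rightarrow> 'v \<Rightarrow> 'v \<Rightarrow> 'k" where
  "bdry_entry C I k u v = coord (chain_space C (k - 1)) (I (k - 1)) (bdry C k v) u"

text \<open>
  A vertex is a pair of a degree and a basis vector of that degree, an edge the pair of its source
  and target; parallel edges do not occur.
\<close>

type_synonym 'v vertex = "int \<times> 'v"
type_synonym 'v edge = "'v vertex \<times> 'v vertex"

definition complex_graph ::
    "('k::field, 'v) chain_complex \<Rightarrow> (int \<Rightarrow> 'v set) \<Rightarrow> 'v vertex pair_pre_digraph" where
  "complex_graph C I =
     \<lparr> pverts = (SIGMA k:UNIV. I k),
       parcs = {((k, v), (k - 1, u)) | k u v. v \<in> I k \<and> u \<in> I (k - 1) \<and> bdry_entry C I k u v \<noteq> 0} \<rparr>"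

definition edge_weight ::
    "('k::field, 'v) chain_complex \<Rightarrow> (int \<Rightarrow> 'v set) \<Rightarrow> 'v edge \<Rightarrow> 'k" where
  "edge_weight C I e = bdry_entry C I (fst (fst e)) (snd (snd e)) (snd (fst e))"

definition morse_graph ::
    "('k::field, 'v) chain_complex \<Rightarrow> (int \<Rightarrow> 'v set) \<Rightarrow> 'v edge set \<Rightarrow> 'v vertex pair_pre_digraph" where
  "morse_graph C I M =
     \<lparr> pverts = pverts (complex_graph C I), parcs = (parcs (complex_graph C I) - M) \<union> M\<inverse> \<rparr>"

definition morse_weight ::
    "('k::field, 'v) chain_complex \<Rightarrow> (int \<Rightarrow> 'v set) \<Rightarrow> 'v edge set \<Rightarrow> 'v edge \<Rightarrow> 'k" where
  "morse_weight C I M e =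
     (if e \<in> M\<inverse> then - 1 / edge_weight C I (prod.swap e) else edge_weight C I e)"

text \<open>
  The condition excluding infinite paths that alternate between two degrees is omitted, because
  the graph of a finite-dimensional complex is finite.
\<close>

definition morse_matching ::
    "('k::field, 'v) chain_complex \<Rightarrow> (int \<Rightarrow> 'v set) \<Rightarrow> 'v edge set \<Rightarrow> bool" where
  "morse_matching C I M \<longleftrightarrow>
     M \<subseteq> parcs (complex_graph C I) \<and>
     (\<forall>e\<in>M. \<forall>e'\<in>M. e \<noteq> e' \<longrightarrow> {fst e, snd e} \<inter> {fst e', snd e'} = {}) \<and>
     (\<forall>e\<in>M. edge_weight C I e dvd 1) \<and>
     \<not> (\<exists>p. pre_digraph.cycle (with_proj (morse_graph C I M)) p)"

definition critical :: "(int \<Rightarrow> 'v set) \<Rightarrow> 'v edge set \<Rightarrow> int \<Rightarrow> 'v set" where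
  "critical I M k = {v \<in> I k. \<forall>e\<in>M. (k, v) \<noteq> fst e \<and> (k, v) \<noteq> snd e}"

definition morse_paths ::
    "('k::field, 'v) chain_complex \<Rightarrow> (int \<Rightarrow> 'v set) \<Rightarrow> 'v edge set \<Rightarrow> 'v vertex \<Rightarrow> 'v vertex \<Rightarrow>
     'v edge list set" where
  "morse_paths C I M a b = {\<gamma>. pre_digraph.apath (with_proj (morse_graph C I M)) a \<gamma> b}"

definition path_weight ::
    "('k::field, 'v) chain_complex \<Rightarrow> (int \<Rightarrow> 'v set) \<Rightarrow> 'v edge set \<Rightarrow> 'v edge list \<Rightarrow> 'k" where
  "path_weight C I M \<gamma> = prod_list (map (morse_weight C I M) \<gamma>)"

text \<open>
  For a vertex \<open>a\<close> and a set \<open>J\<close> of basis vectors in degree \<open>l\<close>, \<open>path_sum C I M a l J\<close> is the sum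
  of the vectors $\partial_\gamma(a)$ over all $u \in J$ and all paths $\gamma$ from \<open>a\<close> to $u$.
\<close>

definition path_sum ::
    "('k::field, 'v) chain_complex \<Rightarrow> (int \<Rightarrow> 'v set) \<Rightarrow> 'v edge set \<Rightarrow> 'v vertex \<Rightarrow> int \<Rightarrow> 'v set \<Rightarrow> 'v" where
  "path_sum C I M a l J =
     finsum (chain_space C l) (\<lambda>(u, \<gamma>). path_weight C I M \<gamma> \<odot>\<^bsub>chain_space C l\<^esub> u)
       (SIGMA u:J. morse_paths C I M a (l, u))"

definition lin_ext ::
    "('k::field, 'v) module \<Rightarrow> 'v set \<Rightarrow> ('k, 'w) module \<Rightarrow> ('v \<Rightarrow> 'w) \<Rightarrow> 'v \<Rightarrow> 'w" where
  "lin_ext V B W h x = (\<Oplus>\<^bsub>W\<^esub> b \<in> B. coord V B x b \<odot>\<^bsub>W\<^esub> h b)"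

text \<open>
  The vector space with basis \<open>critical I M k\<close> is realised as the span of these basis vectors in
  \<open>chain_space C k\<close>, so that iterated reductions stay within one type.  Its coordinates, and sums of
  its elements, can therefore be taken in \<open>chain_space C k\<close>.
\<close>

definition reduced_complex ::
    "('k::field, 'v) chain_complex \<Rightarrow> (int \<Rightarrow> 'v set) \<Rightarrow> 'v edge set \<Rightarrow> ('k, 'v) chain_complex" where
  "reduced_complex C I M =
     \<lparr> chain_space = (\<lambda>k. (chain_space C k)\<lparr>carrier :=
                   LinearCombinations.module.span class_ring (chain_space C k) (critical I M k)\<rparr>),
       bdry = (\<lambda>k. lin_ext (chain_space C k) (critical I M k) (chain_space C (k - 1))
                   (\<lambda>v'. path_sum C I M (k, v') (k - 1) (critical I M (k - 1)))) \<rparr>"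

definition reduction_f ::
    "('k::field, 'v) chain_complex \<Rightarrow> (int \<Rightarrow> 'v set) \<Rightarrow> 'v edge set \<Rightarrow> int \<Rightarrow> 'v \<Rightarrow> 'v" where
  "reduction_f C I M k =
     lin_ext (chain_space C k) (critical I M k) (chain_space C k) (\<lambda>v'. path_sum C I M (k, v') k (I k))"

definition reduction_g ::
    "('k::field, 'v) chain_complex \<Rightarrow> (int \<Rightarrow> 'v set) \<Rightarrow> 'v edge set \<Rightarrow> int \<Rightarrow> 'v \<Rightarrow> 'v" where
  "reduction_g C I M k =
     lin_ext (chain_space C k) (I k) (chain_space C k) (\<lambda>v. path_sum C I M (k, v) k (critical I M k))"

definition reduction_step ::
    "('k::field, 'v) chain_complex \<Rightarrow> ('k, 'v) chain_complex \<Rightarrow>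
     (int \<Rightarrow> 'v \<Rightarrow> 'v) \<Rightarrow> (int \<Rightarrow> 'v \<Rightarrow> 'v) \<Rightarrow> bool" where
  "reduction_step C C' f g \<longleftrightarrow>
     (\<exists>I M. (\<forall>k. vectorspace.basis class_ring (chain_space C k) (I k)) \<and>
            morse_matching C I M \<and> M \<noteq> {} \<and>
            C' = reduced_complex C I M \<and> f = reduction_f C I M \<and> g = reduction_g C I M)"

inductive reductions ::
    "('k::field, 'v) chain_complex \<Rightarrow> ('k, 'v) chain_complex \<Rightarrow>
     (int \<Rightarrow> 'v \<Rightarrow> 'v) \<Rightarrow> (int \<Rightarrow> 'v \<Rightarrow> 'v) \<Rightarrow> bool"
  for C where
  refl: "reductions C C graded_id graded_id"
| step: "reductions C C' f g \<Longrightarrow> reduction_step C' C'' f' g' \<Longrightarrow>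
         reductions C C'' (f \<circ>\<^sub>g f') (g' \<circ>\<^sub>g g)"

definition complete_reduction ::
    "('k::field, 'v) chain_complex \<Rightarrow> ('k, 'v) chain_complex \<Rightarrow>
     (int \<Rightarrow> 'v \<Rightarrow> 'v) \<Rightarrow> (int \<Rightarrow> 'v \<Rightarrow> 'v) \<Rightarrow> bool" where
  "complete_reduction C C' f g \<longleftrightarrow> reductions C C' f g \<and> zero_boundaries C'"

end

theory Submission
  imports Defs
begin

text \<open>
  Fix bases of a complex \<open>C\<close> with boundary \<open>d\<close> and a Morse matching.  Let \<open>N\<close> be the matrix of the
  weights of the arcs of the matched graph.  Since the graph is finite and acyclic, every walk is a
  path, and the matrix \<open>P\<close> of the sums of path weights is the finite geometric series
  \<open>1 + N + N N + \<dots>\<close>; it satisfies \<open>P = 1 + N P = 1 + P N\<close>.  For a matched edge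
  from \<open>v\<close> down to \<open>u\<close>, call \<open>v\<close> a source and \<open>u\<close> a target.  A step up leads from a target to a
  source, and no vertex is both, so two steps up never follow each other.  Hence no path gains two
  degrees, and a path that gains one degree begins in a target and ends in a source.

  Let \<open>h\<close> be the linear map of degree \<open>1\<close> given by the paths that gain one degree, and \<open>p\<close> the
  projection to the span of the critical vectors along all other basis vectors.  By the above, \<open>h\<close>
  vanishes on critical vectors and on sources, and its values lie in the span of the sources.  The two
  recursions for \<open>P\<close> say that \<open>x + h (d x) = 0\<close> for \<open>x\<close> in the span of the sources
  (\<open>source_row\<close>) and that \<open>x + d (h x)\<close> never has a component along a target (\<open>target_column\<close>).
  Read at critical vertices, they also turn the path sums of a reduction into formulas in \<open>h\<close>:
  \<open>f = 1 + h d\<close> on critical vectors, \<open>g = p (1 + d h)\<close>, and the new boundary is \<open>g d\<close>.  From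
  these properties of \<open>h\<close> alone it follows that \<open>f\<close> and \<open>g\<close> are chain maps, that \<open>g f = 1\<close>, and
  that \<open>f (g x) = x + d (h x)\<close> for every cycle \<open>x\<close> (locale \<open>matching_contraction\<close>).

  Such pairs \<open>(f, g)\<close> compose, so every sequence of reductions yields one.  If the final complex
  \<open>C'\<close> has zero boundaries, then \<open>x \<mapsto> [f x]\<close> maps \<open>C'\<close> to the homology of \<open>C\<close>.  It is injective
  because \<open>g f = 1\<close> and \<open>g\<close> kills boundaries, surjective because \<open>f (g z)\<close> is homologous to \<open>z\<close>,
  and natural for the same reason.  In a composite \<open>g \<psi> (f g) \<phi> f\<close> the inner \<open>f g\<close> changes cycles
  by boundaries only, and these are killed by the chain map \<open>g \<psi>\<close>, which gives functoriality.

  Complete reductions exist because a single edge on a nonzero entry of the boundary is already a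
  Morse matching, and each step makes the basis smaller.
\<close>

section \<open>Linear maps\<close>

lemma linear_mapI:
  fixes V :: "('k::field, 'v) module" and W :: "('k, 'w) module"
  assumes "vectorspace class_ring V" "vectorspace class_ring W"
    and "\<And>x. x \<in> carrier V \<Longrightarrow> T x \<in> carrier W"
    and "\<And>x y. x \<in> carrier V \<Longrightarrow> y \<in> carrier V \<Longrightarrow> T (x \<oplus>\<^bsub>V\<^esub> y) = T x \<oplus>\<^bsub>W\<^esub> T y"
    and "\<And>c x. x \<in> carrier V \<Longrightarrow> T (c \<odot>\<^bsub>V\<^esub> x) = c \<odot>\<^bsub>W\<^esub> T x"
  shows "linear_map class_ring V W T"
  using assms
  by (auto simp: linear_map_def mod_hom_def mod_hom_axioms_def LinearCombinations.module_hom_def vectorspace_def)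

lemma linear_mapD:
  fixes V :: "('k::field, 'v) module" and W :: "('k, 'w) module"
  assumes "linear_map class_ring V W T"
  shows "vectorspace class_ring V" "vectorspace class_ring W"
    and "x \<in> carrier V \<Longrightarrow> T x \<in> carrier W"
    and "x \<in> carrier V \<Longrightarrow> y \<in> carrier V \<Longrightarrow> T (x \<oplus>\<^bsub>V\<^esub> y) = T x \<oplus>\<^bsub>W\<^esub> T y"
    and "x \<in> carrier V \<Longrightarrow> T (c \<odot>\<^bsub>V\<^esub> x) = c \<odot>\<^bsub>W\<^esub> T x"
    and "T \<zero>\<^bsub>V\<^esub> = \<zero>\<^bsub>W\<^esub>"
proof -
  interpret linear_map class_ring V W T by fact
  show "vectorspace class_ring V" "vectorspace class_ring W" by unfold_locales
  show "x \<in> carrier V \<Longrightarrow> T x \<in> carrier W"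
    "x \<in> carrier V \<Longrightarrow> y \<in> carrier V \<Longrightarrow> T (x \<oplus>\<^bsub>V\<^esub> y) = T x \<oplus>\<^bsub>W\<^esub> T y"
    "x \<in> carrier V \<Longrightarrow> T (c \<odot>\<^bsub>V\<^esub> x) = c \<odot>\<^bsub>W\<^esub> T x"
    "T \<zero>\<^bsub>V\<^esub> = \<zero>\<^bsub>W\<^esub>"
    by auto
qed

lemma linear_map_id:
  fixes V :: "('k::field, 'v) module"
  shows "vectorspace class_ring V \<Longrightarrow> linear_map class_ring V V (\<lambda>x. x)"
  by (rule linear_mapI) auto

lemma linear_map_comp:
  fixes U :: "('k::field, 'u) module" and V :: "('k, 'v) module" and W :: "('k, 'w) module"
  assumes "linear_map class_ring U V S" "linear_map class_ring V W T"
  shows "linear_map class_ring U W (\<lambda>x. T (S x))"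
  using linear_mapD[OF assms(1)] linear_mapD[OF assms(2)] by (intro linear_mapI) auto

lemma linear_map_add:
  fixes V :: "('k::field, 'v) module" and W :: "('k, 'w) module"
  assumes "linear_map class_ring V W S" "linear_map class_ring V W T"
  shows "linear_map class_ring V W (\<lambda>x. S x \<oplus>\<^bsub>W\<^esub> T x)"
proof -
  note S = linear_mapD[OF assms(1)] and T = linear_mapD[OF assms(2)]
  interpret W: vectorspace class_ring W by (rule S(2))
  show ?thesis
    by (rule linear_mapI)
      (use S T in \<open>auto simp: W.a_ac W.smult_r_distr\<close>)
qed

lemma linear_map_cong:
  fixes V :: "('k::field, 'v) module" and W :: "('k, 'w) module"
  assumes "linear_map class_ring V W S" "\<And>x. x \<in> carrier V \<Longrightarrow> T x = S x"
  shows "linear_map class_ring V W T"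
proof -
  note S = linear_mapD[OF assms(1)]
  interpret V: vectorspace class_ring V by (rule S(1))
  show ?thesis
    by (rule linear_mapI) (use S assms(2) in auto)
qed

lemma linear_map_subspace:
  fixes V :: "('k::field, 'v) module" and W :: "('k, 'w) module"
  assumes "linear_map class_ring V W T" "submodule class_ring S V" "submodule class_ring S' W"
    and "\<And>x. x \<in> S \<Longrightarrow> T x \<in> S'"
  shows "linear_map class_ring (V\<lparr>carrier := S\<rparr>) (W\<lparr>carrier := S'\<rparr>) T"
proof -
  note T = linear_mapD[OF assms(1)]
  have S: "x \<in> carrier V" if "x \<in> S" for x using assms(2) that by (auto simp: submodule_def)
  have "vectorspace class_ring (V\<lparr>carrier := S\<rparr>)"
    by (intro vectorspace.subspace_is_vs T(1) subspace.intro assms(2))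
  moreover have "vectorspace class_ring (W\<lparr>carrier := S'\<rparr>)"
    by (intro vectorspace.subspace_is_vs T(2) subspace.intro assms(3))
  ultimately show ?thesis
    by (intro linear_mapI) (use S T assms(4) in auto)
qed

section \<open>Coordinates and linear extension\<close>

text \<open>Only independence is assumed.  In a reduced complex the coordinates with respect to the critical
  vectors are taken in the ambient space, where these vectors span a subspace.\<close>

locale free_family = vectorspace "class_ring :: 'k::field ring" V
  for V :: "('k::field, 'v) module" +
  fixes B :: "'v set"
  assumes finite_B: "finite B" and B_sub: "B \<subseteq> carrier V" and indpt: "lin_indpt B"
begin

lemma lincomb_unique:
  assumes "lincomb a B = lincomb b B" "v \<in> B"
  shows "a v = b v"
proof (rule ccontr)
  assume "a v \<noteq> b v"
  moreover have "lincomb (\<lambda>v. a v - b v) B = \<zero>\<^bsub>V\<^esub>"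
    using lincomb_diff[OF finite_B B_sub, of a b] assms(1) lincomb_closed[OF B_sub, of b]
    by (simp add: class_ring_simps)
  ultimately show False
    using indpt lin_dep_crit[OF finite_B subset_refl, of "\<lambda>v. a v - b v" v] assms(2) by auto
qed

lemma coord_lincomb:
  "coord V B (lincomb a B) v = (if v \<in> B then a v else 0)"
proof -
  let ?a = "\<lambda>v. if v \<in> B then a v else 0"
  have "lincomb ?a B = lincomb a B"
    by (rule lincomb_cong) (use B_sub in auto)
  moreover have "b = ?a" if "\<forall>v. v \<notin> B \<longrightarrow> b v = 0" "lincomb b B = lincomb a B" for b
    using that lincomb_unique[of b a] by auto
  ultimately have "coord V B (lincomb a B) = ?a"
    unfolding coord_def by (intro the_equality) auto
  then show ?thesis by simp
qed

lemma span_B: "x \<in> span B \<longleftrightarrow> (\<exists>a. x = lincomb a B)"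
  using finite_span[OF finite_B B_sub] by auto

lemma span_sub: "span B \<subseteq> carrier V"
  by (rule span_is_subset2[OF B_sub])

lemma lincomb_coord: "x \<in> span B \<Longrightarrow> lincomb (coord V B x) B = x"
  unfolding span_B using B_sub by (auto intro!: lincomb_cong simp: coord_lincomb)

lemma coord_outside: "x \<in> span B \<Longrightarrow> v \<notin> B \<Longrightarrow> coord V B x v = 0"
  unfolding span_B by (auto simp: coord_lincomb)

lemma span_eqI:
  assumes "x \<in> span B" "y \<in> span B" "\<And>v. v \<in> B \<Longrightarrow> coord V B x v = coord V B y v"
  shows "x = y"
proof -
  have "lincomb (coord V B x) B = lincomb (coord V B y) B"
    by (rule lincomb_cong) (use assms B_sub in auto)
  then show ?thesis using lincomb_coord assms by simp
qed

lemma span_add: "x \<in> span B \<Longrightarrow> y \<in> span B \<Longrightarrow> x \<oplus>\<^bsub>V\<^esub> y \<in> span B"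
  and span_smult: "x \<in> span B \<Longrightarrow> c \<odot>\<^bsub>V\<^esub> x \<in> span B"
  and span_zero: "\<zero>\<^bsub>V\<^esub> \<in> span B"
  using span_is_submodule[OF B_sub] by (auto simp: submodule_def)

lemma coord_add:
  assumes "x \<in> span B" "y \<in> span B"
  shows "coord V B (x \<oplus>\<^bsub>V\<^esub> y) v = coord V B x v + coord V B y v"
proof -
  obtain a b where "x = lincomb a B" "y = lincomb b B" using assms span_B by auto
  then show ?thesis
    using lincomb_sum[OF finite_B B_sub, of a b] coord_lincomb[of "\<lambda>v. a v + b v" v]
    by (simp add: coord_lincomb)
qed

lemma coord_smult:
  assumes "x \<in> span B"
  shows "coord V B (c \<odot>\<^bsub>V\<^esub> x) v = c * coord V B x v"
proof -
  obtain a where "x = lincomb a B" using assms span_B by auto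
  then show ?thesis
    using lincomb_smult[OF B_sub, of a c] coord_lincomb[of "\<lambda>v. c * a v" v]
    by (simp add: coord_lincomb)
qed

lemma coord_zero: "coord V B \<zero>\<^bsub>V\<^esub> v = 0"
  using coord_smult[OF span_zero, of 0 v] by simp

lemma coord_finsum:
  assumes "finite A" "f \<in> A \<rightarrow> span B"
  shows "finsum V f A \<in> span B \<and> coord V B (finsum V f A) v = (\<Sum>i\<in>A. coord V B (f i) v)"
  using assms
proof (induction A)
  case empty
  then show ?case by (simp add: coord_zero span_zero)
next
  case (insert x A)
  then have "f x \<in> span B" "f \<in> A \<rightarrow> span B" "f \<in> A \<rightarrow> carrier V" "f x \<in> carrier V"
    using span_sub by auto
  then show ?case using insert by (simp add: coord_add span_add)
qed

lemma B_sub_span: "b \<in> B \<Longrightarrow> b \<in> span B"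
  using in_own_span[OF B_sub] by auto

lemma coord_basis:
  assumes "b \<in> B" shows "coord V B b v = (if v = b then 1 else 0)"
proof -
  let ?a = "\<lambda>v. if v = b then 1 else (0::'k)"
  have "lincomb ?a B = ?a b \<odot>\<^bsub>V\<^esub> b \<oplus>\<^bsub>V\<^esub> lincomb ?a (B - {b})"
    by (rule lincomb_del2) (use finite_B B_sub assms in auto)
  also have "lincomb ?a (B - {b}) = lincomb (\<lambda>_. 0) (B - {b})"
    by (rule lincomb_cong) (use B_sub in auto)
  also have "\<dots> = \<zero>\<^bsub>V\<^esub>"
    unfolding lincomb_def by (rule finsum_all0) (use B_sub lmult_0 in auto)
  finally have "lincomb ?a B = b" using assms B_sub smult_one[of b] by auto
  then show ?thesis using coord_lincomb[of ?a v] assms by auto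
qed

lemma free_subfamily: "S \<subseteq> B \<Longrightarrow> free_family V S"
  using finite_B B_sub indpt subset_li_is_li
  by unfold_locales (auto intro: finite_subset)

text \<open>Padding coefficients by zero turns a combination of \<open>S\<close> into one of \<open>B\<close>, and independence
  leaves no other.\<close>

lemma coord_subfamily:
  assumes "S \<subseteq> B" "x \<in> span S"
  shows "coord V S x = coord V B x"
proof -
  interpret S: free_family V S by (rule free_subfamily[OF assms(1)])
  obtain a where a: "x = lincomb a S" using assms S.span_B by auto
  have "lincomb a S = lincomb (\<lambda>v. if v \<in> S then a v else 0) S"
    by (rule lincomb_cong) (use S.B_sub in auto)
  also have "\<dots> = lincomb (\<lambda>v. if v \<in> S then a v else 0) B"
    unfolding lincomb_def
    by (rule add.finprod_mono_neutral_cong_left)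
      (use assms finite_B B_sub S.B_sub lmult_0 in auto)
  finally show ?thesis
    using S.coord_lincomb[of a] coord_lincomb[of "\<lambda>v. if v \<in> S then a v else 0"] assms(1)
    unfolding a by (intro ext) (simp, blast)
qed

lemma mem_span_subfamily:
  assumes "S \<subseteq> B" "x \<in> span B" "\<And>v. v \<in> B - S \<Longrightarrow> coord V B x v = 0"
  shows "x \<in> span S"
proof -
  have "x = lincomb (coord V B x) B" using lincomb_coord assms(2) by simp
  also have "\<dots> = lincomb (coord V B x) S"
    unfolding lincomb_def
    by (rule add.finprod_mono_neutral_cong_right)
      (use assms finite_B B_sub lmult_0 in auto)
  finally show ?thesis
    using free_family.span_B[OF free_subfamily[OF assms(1)]] by blast
qed

lemma span_subfamily_iff:
  assumes "S \<subseteq> B"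
  shows "x \<in> span S \<longleftrightarrow> x \<in> span B \<and> (\<forall>v\<in>B - S. coord V B x v = 0)"
proof
  assume x: "x \<in> span S"
  interpret S: free_family V S by (rule free_subfamily[OF assms])
  show "x \<in> span B \<and> (\<forall>v\<in>B - S. coord V B x v = 0)"
    using span_is_monotone[OF assms] x S.coord_outside[OF x] coord_subfamily[OF assms x] by auto
qed (use mem_span_subfamily[OF assms] in auto)

lemma coord_summand_closed:
  fixes W :: "('k, 'w) module"
  assumes "vectorspace class_ring W" "h \<in> B \<rightarrow> carrier W" "B' \<subseteq> B"
  shows "(\<lambda>b. a b \<odot>\<^bsub>W\<^esub> h b) \<in> B' \<rightarrow> carrier W"
proof -
  interpret W: vectorspace class_ring W by fact
  show ?thesis using assms by (auto intro!: W.smult_closed)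
qed

lemma lin_ext_linear:
  fixes W :: "('k, 'w) module"
  assumes W: "vectorspace class_ring W" and h: "h \<in> B \<rightarrow> carrier W"
  shows "linear_map class_ring (V\<lparr>carrier := span B\<rparr>) W (lin_ext V B W h)"
proof (rule linear_mapI)
  interpret W: vectorspace class_ring W by fact
  note cl = coord_summand_closed[OF W h subset_refl]
  have hc: "b \<in> B \<Longrightarrow> h b \<in> carrier W" for b using h by auto
  show "vectorspace class_ring (V\<lparr>carrier := span B\<rparr>)"
    by (intro subspace_is_vs span_is_subspace B_sub)
  show "lin_ext V B W h x \<in> carrier W" for x
    unfolding lin_ext_def using cl by (intro W.finsum_closed) auto
  show "lin_ext V B W h (x \<oplus>\<^bsub>V\<lparr>carrier := span B\<rparr>\<^esub> y) = lin_ext V B W h x \<oplus>\<^bsub>W\<^esub> lin_ext V B W h y"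
    if "x \<in> carrier (V\<lparr>carrier := span B\<rparr>)" "y \<in> carrier (V\<lparr>carrier := span B\<rparr>)" for x y
  proof -
    have "lin_ext V B W h (x \<oplus>\<^bsub>V\<^esub> y) =
        (\<Oplus>\<^bsub>W\<^esub> b \<in> B. coord V B x b \<odot>\<^bsub>W\<^esub> h b \<oplus>\<^bsub>W\<^esub> coord V B y b \<odot>\<^bsub>W\<^esub> h b)"
      unfolding lin_ext_def using that hc W.smult_l_distr
      by (intro W.finsum_cong') (auto simp: coord_add)
    then show ?thesis unfolding lin_ext_def using W.finsum_addf[OF cl cl] by simp
  qed
  show "lin_ext V B W h (c \<odot>\<^bsub>V\<lparr>carrier := span B\<rparr>\<^esub> x) = c \<odot>\<^bsub>W\<^esub> lin_ext V B W h x"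
    if "x \<in> carrier (V\<lparr>carrier := span B\<rparr>)" for c x
  proof -
    have "lin_ext V B W h (c \<odot>\<^bsub>V\<^esub> x) = (\<Oplus>\<^bsub>W\<^esub> b \<in> B. c \<odot>\<^bsub>W\<^esub> (coord V B x b \<odot>\<^bsub>W\<^esub> h b))"
      unfolding lin_ext_def using that hc W.smult_assoc1
      by (intro W.finsum_cong') (auto simp: coord_smult)
    then show ?thesis unfolding lin_ext_def using W.finsum_smult[OF _ cl, of c] by simp
  qed
qed (rule W)

text \<open>This identifies a map that is prescribed on a basis, such as by path sums, with any composite of
  linear maps that takes the same values there.\<close>

lemma lin_ext_of_linear:
  fixes W :: "('k, 'w) module"
  assumes T: "linear_map class_ring V W T" and h: "\<And>b. b \<in> B \<Longrightarrow> h b = T b" and x: "x \<in> span B"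
  shows "lin_ext V B W h x = T x"
proof -
  interpret W: vectorspace class_ring W by (rule linear_mapD(2)[OF T])
  interpret T: linear_map class_ring V W T by fact
  have "T x = T (lincomb (coord V B x) B)" using lincomb_coord x by simp
  also have "\<dots> = (\<Oplus>\<^bsub>W\<^esub> b \<in> B. T (coord V B x b \<odot>\<^bsub>V\<^esub> b))"
    unfolding lincomb_def by (rule T.hom_sum) (use B_sub in auto)
  also have "\<dots> = lin_ext V B W h x"
    unfolding lin_ext_def using B_sub h by (intro W.finsum_cong') auto
  finally show ?thesis by simp
qed

lemma lin_ext_basis:
  fixes W :: "('k, 'w) module"
  assumes W: "vectorspace class_ring W" and h: "h \<in> B \<rightarrow> carrier W" and b: "b \<in> B"
  shows "lin_ext V B W h b = h b"
proof -
  interpret W: vectorspace class_ring W by fact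
  have hc: "b \<in> B \<Longrightarrow> h b \<in> carrier W" for b using h by auto
  have "lin_ext V B W h b = (\<Oplus>\<^bsub>W\<^esub> b' \<in> B. if b' = b then h b' else \<zero>\<^bsub>W\<^esub>)"
    unfolding lin_ext_def using hc b W.lmult_0
    by (intro W.finsum_cong') (auto simp: coord_basis W.smult_one[simplified])
  also have "\<dots> = h b"
    using W.add.finprod_singleton_swap[of b B h] b finite_B h by simp
  finally show ?thesis .
qed

lemma coord_linear:
  fixes W :: "('k, 'w) module"
  assumes T: "linear_map class_ring V W T" and x: "x \<in> span B"
    and W: "free_family W B'" and full: "LinearCombinations.module.span class_ring W B' = carrier W"
  shows "coord W B' (T x) u = (\<Sum>b\<in>B. coord V B x b * coord W B' (T b) u)"
proof -
  interpret W: free_family W B' by fact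
  note T' = linear_mapD[OF T]
  have Tb: "b \<in> B \<Longrightarrow> T b \<in> W.span B'" for b using T' B_sub full by auto
  have "T x = lin_ext V B W T x" using lin_ext_of_linear[OF T _ x] by simp
  then have "coord W B' (T x) u = (\<Sum>b\<in>B. coord W B' (coord V B x b \<odot>\<^bsub>W\<^esub> T b) u)"
    unfolding lin_ext_def using W.coord_finsum[OF finite_B, of "\<lambda>b. coord V B x b \<odot>\<^bsub>W\<^esub> T b" u]
      Tb W.span_smult by auto
  then show ?thesis using Tb by (simp add: W.coord_smult)
qed

end

section \<open>Quotient spaces and homology\<close>

text \<open>The vector space axioms are equations, apart from the existence of negatives, so a surjection
  that respects the operations transports all of them.  For quotients this replaces reasoning about
  sets of representatives.\<close>

lemma vectorspace_surj_image:
  fixes V :: "('k::field, 'v) module" and Q :: "('k, 'w) module"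
  assumes V: "vectorspace class_ring V"
    and carr: "carrier Q = T ` carrier V" and zero: "\<zero>\<^bsub>Q\<^esub> = T \<zero>\<^bsub>V\<^esub>"
    and add: "\<And>x y. x \<in> carrier V \<Longrightarrow> y \<in> carrier V \<Longrightarrow> T x \<oplus>\<^bsub>Q\<^esub> T y = T (x \<oplus>\<^bsub>V\<^esub> y)"
    and smult: "\<And>c x. x \<in> carrier V \<Longrightarrow> c \<odot>\<^bsub>Q\<^esub> T x = T (c \<odot>\<^bsub>V\<^esub> x)"
  shows "vectorspace class_ring Q" "linear_map class_ring V Q T"
proof -
  interpret V: vectorspace class_ring V by (rule V)
  have sm: "c \<odot>\<^bsub>V\<^esub> x \<in> carrier V" if "x \<in> carrier V" for c x
    using V.smult_closed[of c x] that by simp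
  have neg: "\<exists>y\<in>carrier V. T (x \<oplus>\<^bsub>V\<^esub> y) = T \<zero>\<^bsub>V\<^esub>" if "x \<in> carrier V" for x
    using that V.r_neg by (intro bexI[of _ "\<ominus>\<^bsub>V\<^esub> x"]) auto
  show *: "vectorspace class_ring Q"
  proof (rule vs_criteria)
    show "\<forall>v\<in>carrier Q. \<exists>w\<in>carrier Q. v \<oplus>\<^bsub>Q\<^esub> w = \<zero>\<^bsub>Q\<^esub>"
      using neg by (auto simp: carr zero add)
  qed (use class_field V.smult_assoc1 V.smult_l_distr V.smult_r_distr V.smult_one in
      \<open>auto simp: carr zero add smult V.a_ac sm\<close>)
  show "linear_map class_ring V Q T"
    by (rule linear_mapI) (use V * in \<open>auto simp: carr add smult\<close>)
qed

lemma submodule_additive_subgroup: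
  fixes V :: "('k::field, 'v) module"
  assumes "vectorspace class_ring V" "submodule class_ring W V"
  shows "abelian_subgroup W V"
proof (rule abelian_subgroupI3)
  interpret V: vectorspace class_ring V by fact
  interpret W: submodule class_ring W V by fact
  show "additive_subgroup W V"
  proof (intro additive_subgroupI subgroup.intro)
    show "inv\<^bsub>add_monoid V\<^esub> x \<in> W" if x: "x \<in> W" for x
    proof -
      have "(- 1) \<odot>\<^bsub>V\<^esub> x = \<ominus>\<^bsub>V\<^esub> x"
        using V.smult_minus_1[of x] x W.subset by (auto simp: class_ring_simps)
      then show ?thesis using W.smult_closed[of "-1" x] x by (simp add: a_inv_def)
    qed
  qed (use W.subset in auto)
  show "abelian_group V" by unfold_locales
qed

text \<open>The scalar multiple of a coset is a union of cosets, one for each representative.  Two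
  representatives differ by some \<open>w \<in> W\<close>, their multiples by \<open>c \<odot> w \<in> W\<close>, so the cosets that are
  united coincide.\<close>

lemma quotient_space_cosets:
  fixes V :: "('k::field, 'v) module"
  assumes V: "vectorspace class_ring V" and W: "submodule class_ring W V"
  shows "vectorspace class_ring (quotient_space V W)"
    and "linear_map class_ring V (quotient_space V W) (\<lambda>x. W +>\<^bsub>V\<^esub> x)"
    and "carrier (quotient_space V W) = (\<lambda>x. W +>\<^bsub>V\<^esub> x) ` carrier V"
    and "x \<in> carrier V \<Longrightarrow> y \<in> carrier V \<Longrightarrow> W +>\<^bsub>V\<^esub> x = W +>\<^bsub>V\<^esub> y \<longleftrightarrow> (\<exists>w\<in>W. x = w \<oplus>\<^bsub>V\<^esub> y)"
proof -
  interpret V: vectorspace class_ring V by (rule V)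
  interpret W: submodule class_ring W V by (rule W)
  interpret A: abelian_subgroup W V by (rule submodule_additive_subgroup[OF V W])
  show carr: "carrier (quotient_space V W) = (\<lambda>x. W +>\<^bsub>V\<^esub> x) ` carrier V"
    by (auto simp: quotient_space_def A_RCOSETS_def')
  show eq: "W +>\<^bsub>V\<^esub> x = W +>\<^bsub>V\<^esub> y \<longleftrightarrow> (\<exists>w\<in>W. x = w \<oplus>\<^bsub>V\<^esub> y)"
    if "x \<in> carrier V" "y \<in> carrier V" for x y
  proof
    assume "W +>\<^bsub>V\<^esub> x = W +>\<^bsub>V\<^esub> y"
    then have "x \<in> W +>\<^bsub>V\<^esub> y" using A.a_rcos_self that by blast
    then show "\<exists>w\<in>W. x = w \<oplus>\<^bsub>V\<^esub> y" by (auto simp: a_r_coset_def')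
  next
    assume "\<exists>w\<in>W. x = w \<oplus>\<^bsub>V\<^esub> y"
    then have "x \<in> W +>\<^bsub>V\<^esub> y" by (auto simp: a_r_coset_def')
    then show "W +>\<^bsub>V\<^esub> x = W +>\<^bsub>V\<^esub> y"
      using V.a_repr_independence[OF _ that(2) A.a_subgroup] by blast
  qed
  have sm: "(\<Union>y\<in>W +>\<^bsub>V\<^esub> x. W +>\<^bsub>V\<^esub> (c \<odot>\<^bsub>V\<^esub> y)) = W +>\<^bsub>V\<^esub> (c \<odot>\<^bsub>V\<^esub> x)"
    if x: "x \<in> carrier V" for c x
  proof -
    have "W +>\<^bsub>V\<^esub> (c \<odot>\<^bsub>V\<^esub> y) = W +>\<^bsub>V\<^esub> (c \<odot>\<^bsub>V\<^esub> x)" if y: "y \<in> W +>\<^bsub>V\<^esub> x" for y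
    proof -
      obtain w where w: "w \<in> W" "y = w \<oplus>\<^bsub>V\<^esub> x" using y by (auto simp: a_r_coset_def')
      then have "c \<odot>\<^bsub>V\<^esub> y = c \<odot>\<^bsub>V\<^esub> w \<oplus>\<^bsub>V\<^esub> c \<odot>\<^bsub>V\<^esub> x" "c \<odot>\<^bsub>V\<^esub> w \<in> W"
        using V.smult_r_distr[of c w x] x W.subset W.smult_closed[of c w] by auto
      then show ?thesis
        using eq[of "c \<odot>\<^bsub>V\<^esub> y" "c \<odot>\<^bsub>V\<^esub> x"] x w W.subset V.smult_closed[of c] by auto
    qed
    then show ?thesis using A.a_rcos_self[OF x] by blast
  qed
  have z: "W +>\<^bsub>V\<^esub> \<zero>\<^bsub>V\<^esub> = W" by (rule V.a_coset_add_zero[OF A.a_subset])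
  show "vectorspace class_ring (quotient_space V W)"
    and "linear_map class_ring V (quotient_space V W) (\<lambda>x. W +>\<^bsub>V\<^esub> x)"
    by (rule vectorspace_surj_image[OF V carr];
        simp add: quotient_space_def z A.a_rcos_sum sm)+
qed

text \<open>The facts about the boundary are stated both from degree \<open>k\<close> and from degree \<open>k + 1\<close>: by
  definition \<open>bdry C (k + 1)\<close> ends in degree \<open>k + 1 - 1\<close>, which blocks matching against degree \<open>k\<close>.\<close>

lemma fd_chain_complexD:
  fixes C :: "('k::field, 'v) chain_complex"
  assumes "fd_chain_complex C"
  shows "vectorspace class_ring (chain_space C k)"
    and "vectorspace.fin_dim class_ring (chain_space C k)"
    and "linear_map class_ring (chain_space C k) (chain_space C (k - 1)) (bdry C k)"
    and "linear_map class_ring (chain_space C (k + 1)) (chain_space C k) (bdry C (k + 1))"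
    and "x \<in> carrier (chain_space C k) \<Longrightarrow> bdry C (k - 1) (bdry C k x) = \<zero>\<^bsub>chain_space C (k - 2)\<^esub>"
    and "x \<in> carrier (chain_space C (k + 1)) \<Longrightarrow> bdry C k (bdry C (k + 1) x) = \<zero>\<^bsub>chain_space C (k - 1)\<^esub>"
proof -
  have lin: "linear_map class_ring (chain_space C k) (chain_space C (k - 1)) (bdry C k)" for k
    using assms by (simp add: fd_chain_complex_def)
  have sq: "\<forall>x\<in>carrier (chain_space C (k + 1)). bdry C k (bdry C (k + 1) x) = \<zero>\<^bsub>chain_space C (k - 1)\<^esub>" for k
    using assms by (simp add: fd_chain_complex_def)
  show "vectorspace class_ring (chain_space C k)"
    and "vectorspace.fin_dim class_ring (chain_space C k)"
    using assms by (simp_all add: fd_chain_complex_def)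
  show "linear_map class_ring (chain_space C k) (chain_space C (k - 1)) (bdry C k)"
    by (rule lin)
  show "linear_map class_ring (chain_space C (k + 1)) (chain_space C k) (bdry C (k + 1))"
    using lin[of "k + 1"] by simp
  show "x \<in> carrier (chain_space C k) \<Longrightarrow> bdry C (k - 1) (bdry C k x) = \<zero>\<^bsub>chain_space C (k - 2)\<^esub>"
    using sq[of "k - 1"] by simp
  show "x \<in> carrier (chain_space C (k + 1)) \<Longrightarrow> bdry C k (bdry C (k + 1) x) = \<zero>\<^bsub>chain_space C (k - 1)\<^esub>"
    using sq[of k] by simp
qed

lemma chain_mapD:
  fixes C D :: "('k::field, 'v) chain_complex"
  assumes "chain_map C D \<phi>"
  shows "linear_map class_ring (chain_space C k) (chain_space D k) (\<phi> k)"
    and "x \<in> carrier (chain_space C k) \<Longrightarrow> bdry D k (\<phi> k x) = \<phi> (k - 1) (bdry C k x)"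
    and "x \<in> carrier (chain_space C (k + 1)) \<Longrightarrow> bdry D (k + 1) (\<phi> (k + 1) x) = \<phi> k (bdry C (k + 1) x)"
proof -
  have comm: "\<forall>x\<in>carrier (chain_space C k). bdry D k (\<phi> k x) = \<phi> (k - 1) (bdry C k x)" for k
    using assms by (simp add: chain_map_def)
  show "linear_map class_ring (chain_space C k) (chain_space D k) (\<phi> k)"
    using assms by (simp add: chain_map_def graded_map_def)
  show "x \<in> carrier (chain_space C k) \<Longrightarrow> bdry D k (\<phi> k x) = \<phi> (k - 1) (bdry C k x)"
    using comm[of k] by simp
  show "x \<in> carrier (chain_space C (k + 1)) \<Longrightarrow> bdry D (k + 1) (\<phi> (k + 1) x) = \<phi> k (bdry C (k + 1) x)"
    using comm[of "k + 1"] by simp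
qed

lemma chain_map_comp:
  assumes "chain_map C D \<phi>" "chain_map D E \<psi>"
  shows "chain_map C E (\<psi> \<circ>\<^sub>g \<phi>)"
  using linear_map_comp[OF chain_mapD(1)[OF assms(1)] chain_mapD(1)[OF assms(2)]]
    chain_mapD(2)[OF assms(1)] chain_mapD(2)[OF assms(2)] linear_mapD(3)[OF chain_mapD(1)[OF assms(1)]]
  by (simp add: chain_map_def graded_map_def graded_comp_def comp_def)

lemma cycles_carrier: "x \<in> cycles C k \<Longrightarrow> x \<in> carrier (chain_space C k)"
  by (simp add: cycles_def)

lemma cycles_submodule:
  fixes C :: "('k::field, 'v) chain_complex"
  assumes "fd_chain_complex C"
  shows "submodule class_ring (cycles C k) (chain_space C k)"
proof -
  interpret linear_map class_ring "chain_space C k" "chain_space C (k - 1)" "bdry C k"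
    by (rule fd_chain_complexD(3)[OF assms])
  show ?thesis using ker_is_submodule by (simp add: ker_def cycles_def)
qed

lemma boundary_in_cycles:
  fixes C :: "('k::field, 'v) chain_complex"
  assumes "fd_chain_complex C" "x \<in> carrier (chain_space C (k + 1))"
  shows "bdry C (k + 1) x \<in> cycles C k"
  using assms fd_chain_complexD(6)[OF assms] linear_mapD(3)[OF fd_chain_complexD(4)[OF assms(1)]]
  by (simp add: cycles_def)

lemma boundaries_submodule:
  fixes C :: "('k::field, 'v) chain_complex"
  assumes "fd_chain_complex C"
  shows "submodule class_ring (boundaries C k) ((chain_space C k)\<lparr>carrier := cycles C k\<rparr>)"
proof -
  note d = linear_mapD[OF fd_chain_complexD(4)[OF assms, of k]]
  have "linear_map class_ring (chain_space C (k + 1)) ((chain_space C k)\<lparr>carrier := cycles C k\<rparr>) (bdry C (k + 1))"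
    by (rule linear_mapI)
      (use d boundary_in_cycles[OF assms, of _ k] vectorspace.subspace_is_vs[OF d(2)]
        subspace.intro[OF d(2) cycles_submodule[OF assms]] in auto)
  then interpret linear_map class_ring "chain_space C (k + 1)"
    "(chain_space C k)\<lparr>carrier := cycles C k\<rparr>" "bdry C (k + 1)" .
  show ?thesis using im_is_submodule by (simp add: im_def boundaries_def)
qed

definition hclass :: "('k, 'v) chain_complex \<Rightarrow> int \<Rightarrow> 'v \<Rightarrow> 'v set" where
  "hclass C k x = boundaries C k +>\<^bsub>chain_space C k\<^esub> x"

text \<open>From here on homology is handled through cycles: the class map is linear and onto, and two cycles
  have the same class iff they differ by a boundary.\<close>

lemma homology_hclass:
  fixes C :: "('k::field, 'v) chain_complex"
  assumes "fd_chain_complex C"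
  shows "vectorspace class_ring (homology C k)"
    and "linear_map class_ring ((chain_space C k)\<lparr>carrier := cycles C k\<rparr>) (homology C k) (hclass C k)"
    and "carrier (homology C k) = hclass C k ` cycles C k"
    and "x \<in> cycles C k \<Longrightarrow> y \<in> cycles C k \<Longrightarrow> hclass C k x = hclass C k y \<longleftrightarrow>
      (\<exists>z\<in>carrier (chain_space C (k + 1)). x = bdry C (k + 1) z \<oplus>\<^bsub>chain_space C k\<^esub> y)"
proof -
  let ?Z = "(chain_space C k)\<lparr>carrier := cycles C k\<rparr>"
  have Z: "vectorspace class_ring ?Z"
    by (intro vectorspace.subspace_is_vs subspace.intro fd_chain_complexD(1) cycles_submodule assms)
  note q = quotient_space_cosets[OF Z boundaries_submodule[OF assms]]
  have "(\<lambda>x. boundaries C k +>\<^bsub>?Z\<^esub> x) = hclass C k"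
    by (auto simp: hclass_def a_r_coset_def' fun_eq_iff)
  note q = q[unfolded this, folded homology_def]
  show "vectorspace class_ring (homology C k)" by (rule q(1))
  show "linear_map class_ring ?Z (homology C k) (hclass C k)" by (rule q(2))
  show "carrier (homology C k) = hclass C k ` cycles C k" using q(3) by simp
  show "x \<in> cycles C k \<Longrightarrow> y \<in> cycles C k \<Longrightarrow> hclass C k x = hclass C k y \<longleftrightarrow>
      (\<exists>z\<in>carrier (chain_space C (k + 1)). x = bdry C (k + 1) z \<oplus>\<^bsub>chain_space C k\<^esub> y)"
    using quotient_space_cosets(4)[OF Z boundaries_submodule[OF assms], of x y]
    by (auto simp: hclass_def a_r_coset_def' boundaries_def)
qed

lemma chain_map_cycles:
  fixes C D :: "('k::field, 'v) chain_complex"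
  assumes "chain_map C D \<phi>" "x \<in> cycles C k"
  shows "\<phi> k x \<in> cycles D k"
  using assms chain_mapD(2)[OF assms(1), of x k] linear_mapD(3,6)[OF chain_mapD(1)[OF assms(1)]]
  by (simp add: cycles_def)

text \<open>\<open>homology_map\<close> unites the classes of the images of all representatives.  Representatives differ
  by boundaries, which \<open>\<phi>\<close> maps to boundaries, so only one class occurs.\<close>

lemma homology_map_hclass:
  fixes C D :: "('k::field, 'v) chain_complex"
  assumes C: "fd_chain_complex C" and D: "fd_chain_complex D" and \<phi>: "chain_map C D \<phi>"
    and x: "x \<in> cycles C k"
  shows "homology_map C D \<phi> k (hclass C k x) = hclass D k (\<phi> k x)"
proof -
  note d = linear_mapD[OF fd_chain_complexD(4)[OF C, of k]] and p = linear_mapD[OF chain_mapD(1)[OF \<phi>]]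
  have "hclass D k (\<phi> k y) = hclass D k (\<phi> k x)" if y: "y \<in> hclass C k x" for y
  proof -
    obtain z where z: "z \<in> carrier (chain_space C (k + 1))" "y = bdry C (k + 1) z \<oplus>\<^bsub>chain_space C k\<^esub> x"
      using y by (auto simp: hclass_def a_r_coset_def' boundaries_def)
    have "y \<in> cycles C k"
      using z boundary_in_cycles[OF C z(1)] x cycles_submodule[OF C, of k] by (auto simp: submodule_def)
    moreover have "\<phi> k y = bdry D (k + 1) (\<phi> (k + 1) z) \<oplus>\<^bsub>chain_space D k\<^esub> \<phi> k x"
      using z x d p chain_mapD(3)[OF \<phi>] by (auto simp: cycles_carrier)
    ultimately show ?thesis
      using chain_map_cycles[OF \<phi>] x p z by (subst homology_hclass(4)[OF D]) blast+
  qed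
  moreover have "x \<in> hclass C k x"
  proof -
    interpret A: abelian_subgroup "boundaries C k" "(chain_space C k)\<lparr>carrier := cycles C k\<rparr>"
      by (intro submodule_additive_subgroup boundaries_submodule[OF C] vectorspace.subspace_is_vs
          subspace.intro fd_chain_complexD(1) cycles_submodule C)
    show ?thesis using A.a_rcos_self[of x] x by (simp add: hclass_def a_r_coset_def')
  qed
  ultimately show ?thesis unfolding homology_map_def by (fold hclass_def) blast
qed

lemma homology_graded_functor:
  "graded_functor (homology :: ('k::field, 'v) chain_complex \<Rightarrow> _) homology_map"
  unfolding graded_functor_def
proof (intro conjI allI impI; (elim conjE)?)
  fix C D E :: "('k, 'v) chain_complex" and \<phi> \<psi> :: "int \<Rightarrow> 'v \<Rightarrow> 'v"
  assume C: "fd_chain_complex C"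
  show "graded_space (homology C)" by (simp add: graded_space_def homology_hclass(1) C)
  show "graded_eq (homology C) (homology_map C C graded_id) graded_id"
  proof -
    have "chain_map C C graded_id"
      using C by (auto simp: chain_map_def graded_map_def graded_id_def id_def linear_map_id fd_chain_complexD)
    then show ?thesis
      using C by (auto simp: graded_eq_def homology_hclass(3) homology_map_hclass graded_id_def)
  qed
  assume D: "fd_chain_complex D" and \<phi>: "chain_map C D \<phi>"
  show "graded_map (homology C) (homology D) (homology_map C D \<phi>)"
    unfolding graded_map_def
  proof (intro allI linear_mapI)
    fix k
    note h = linear_mapD[OF homology_hclass(2)[OF C, of k]]
      and h' = linear_mapD[OF homology_hclass(2)[OF D, of k]]
      and p = linear_mapD[OF chain_mapD(1)[OF \<phi>, of k]]
    note m = homology_map_hclass[OF C D \<phi>] chain_map_cycles[OF \<phi>] cycles_carrier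
    have cl: "x \<oplus>\<^bsub>chain_space C k\<^esub> y \<in> cycles C k" "c \<odot>\<^bsub>chain_space C k\<^esub> y \<in> cycles C k"
      if "x \<in> cycles C k" "y \<in> cycles C k" for x y c
      using that cycles_submodule[OF C, of k] by (auto simp: submodule_def)
    have hs: "hclass C k x \<oplus>\<^bsub>homology C k\<^esub> hclass C k y = hclass C k (x \<oplus>\<^bsub>chain_space C k\<^esub> y)"
      "c \<odot>\<^bsub>homology C k\<^esub> hclass C k y = hclass C k (c \<odot>\<^bsub>chain_space C k\<^esub> y)"
      if "x \<in> cycles C k" "y \<in> cycles C k" for x y c
      using h that by auto
    show "vectorspace class_ring (homology C k)" "vectorspace class_ring (homology D k)"
      by (rule homology_hclass(1) C D)+
    fix X assume X: "X \<in> carrier (homology C k)"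
    then obtain x where x: "x \<in> cycles C k" "X = hclass C k x" by (auto simp: homology_hclass(3)[OF C])
    show "homology_map C D \<phi> k X \<in> carrier (homology D k)"
      using x m by (simp add: homology_hclass(3)[OF D])
    show "homology_map C D \<phi> k (c \<odot>\<^bsub>homology C k\<^esub> X) = c \<odot>\<^bsub>homology D k\<^esub> homology_map C D \<phi> k X" for c
      using x m(1,2) p(5)[OF m(3)[OF x(1)], of c] h'(5)[of "\<phi> k x" c]
      by (simp add: hs(2)[OF x(1) x(1)] cl(2)[OF x(1) x(1)])
    fix Y assume Y: "Y \<in> carrier (homology C k)"
    then obtain y where y: "y \<in> cycles C k" "Y = hclass C k y" by (auto simp: homology_hclass(3)[OF C])
    show "homology_map C D \<phi> k (X \<oplus>\<^bsub>homology C k\<^esub> Y)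
        = homology_map C D \<phi> k X \<oplus>\<^bsub>homology D k\<^esub> homology_map C D \<phi> k Y"
      using x y m(1,2) p(4)[OF m(3)[OF x(1)] m(3)[OF y(1)]] h'(4)[of "\<phi> k x" "\<phi> k y"]
      by (simp add: hs cl)
  qed
  show "graded_eq (homology C) (homology_map C D \<phi>) (homology_map C D \<psi>)"
    if "chain_map C D \<psi>" "graded_eq (chain_space C) \<phi> \<psi>"
    using that C D \<phi> by (auto simp: graded_eq_def homology_hclass(3) homology_map_hclass cycles_carrier)
  assume E: "fd_chain_complex E" and \<psi>: "chain_map D E \<psi>"
  have "chain_map C E (\<psi> \<circ>\<^sub>g \<phi>)" by (rule chain_map_comp[OF \<phi> \<psi>])
  then show "graded_eq (homology C) (homology_map C E (\<psi> \<circ>\<^sub>g \<phi>)) (homology_map D E \<psi> \<circ>\<^sub>g homology_map C D \<phi>)"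
    using C D E \<phi> \<psi>
    by (auto simp: graded_eq_def homology_hclass(3) homology_map_hclass graded_comp_def chain_map_cycles)
qed

section \<open>Retractions of complexes and homology\<close>

text \<open>What a homotopy equivalence with \<open>g \<circ> f = id\<close> says about cycles.  Instead of a homotopy it is
  only recorded that \<open>f (g x)\<close> is homologous to \<open>x\<close>; this is stable under composition and suffices
  to compare homology.\<close>

definition chain_retraction ::
    "('k::field, 'v) chain_complex \<Rightarrow> ('k, 'v) chain_complex \<Rightarrow>
     (int \<Rightarrow> 'v \<Rightarrow> 'v) \<Rightarrow> (int \<Rightarrow> 'v \<Rightarrow> 'v) \<Rightarrow> bool" where
  "chain_retraction C C' f g \<longleftrightarrow> chain_map C' C f \<and> chain_map C C' g \<and>
     (\<forall>k. \<forall>x\<in>carrier (chain_space C' k). g k (f k x) = x) \<and>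
     (\<forall>k. \<forall>x\<in>cycles C k. \<exists>y\<in>carrier (chain_space C (k + 1)).
        f k (g k x) = bdry C (k + 1) y \<oplus>\<^bsub>chain_space C k\<^esub> x)"

lemma chain_retraction_id:
  assumes "fd_chain_complex C"
  shows "chain_retraction C C graded_id graded_id"
proof -
  have "\<exists>y\<in>carrier (chain_space C (k + 1)). x = bdry C (k + 1) y \<oplus>\<^bsub>chain_space C k\<^esub> x"
    if "x \<in> cycles C k" for k x
  proof -
    interpret V: vectorspace class_ring "chain_space C k" by (rule fd_chain_complexD(1)[OF assms])
    interpret U: vectorspace class_ring "chain_space C (k + 1)" by (rule fd_chain_complexD(1)[OF assms])
    show ?thesis
      using linear_mapD(6)[OF fd_chain_complexD(4)[OF assms, of k]] that
      by (intro bexI[of _ "\<zero>\<^bsub>chain_space C (k + 1)\<^esub>"]) (auto simp: cycles_def)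
  qed
  then show ?thesis
    using assms by (auto simp: chain_retraction_def chain_map_def graded_map_def graded_id_def id_def
        linear_map_id fd_chain_complexD)
qed

text \<open>For a cycle \<open>x\<close> of \<open>C\<close>, the inner pair changes the cycle \<open>g x\<close> by a boundary of \<open>C'\<close>, which \<open>f\<close>
  carries to a boundary of \<open>C\<close>; the outer pair adds another boundary of \<open>C\<close>.\<close>

lemma chain_retraction_comp:
  assumes C: "fd_chain_complex C" and C': "fd_chain_complex C'"
    and r: "chain_retraction C C' f g" and r': "chain_retraction C' C'' f' g'"
  shows "chain_retraction C C'' (f \<circ>\<^sub>g f') (g' \<circ>\<^sub>g g)"
proof -
  have m: "chain_map C' C f" "chain_map C C' g" "chain_map C'' C' f'" "chain_map C' C'' g'"
    using r r' by (auto simp: chain_retraction_def)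
  note lin = linear_mapD[OF chain_mapD(1)[OF m(1)]] linear_mapD(3)[OF chain_mapD(1)[OF m(2)]]
    linear_mapD(3)[OF chain_mapD(1)[OF m(3)]] linear_mapD(3)[OF chain_mapD(1)[OF m(4)]]
  have "\<exists>y\<in>carrier (chain_space C (k + 1)).
        f k (f' k (g' k (g k x))) = bdry C (k + 1) y \<oplus>\<^bsub>chain_space C k\<^esub> x" if x: "x \<in> cycles C k" for k x
  proof -
    interpret V: vectorspace class_ring "chain_space C k" by (rule fd_chain_complexD(1)[OF C])
    interpret U: vectorspace class_ring "chain_space C (k + 1)" by (rule fd_chain_complexD(1)[OF C])
    note d = linear_mapD[OF fd_chain_complexD(4)[OF C, of k]]
      and d' = linear_mapD[OF fd_chain_complexD(4)[OF C', of k]]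
    have gx: "g k x \<in> cycles C' k" by (rule chain_map_cycles[OF m(2) x])
    obtain y' where y': "y' \<in> carrier (chain_space C' (k + 1))"
      "f' k (g' k (g k x)) = bdry C' (k + 1) y' \<oplus>\<^bsub>chain_space C' k\<^esub> g k x"
      using r' gx unfolding chain_retraction_def by blast
    obtain y where y: "y \<in> carrier (chain_space C (k + 1))"
      "f k (g k x) = bdry C (k + 1) y \<oplus>\<^bsub>chain_space C k\<^esub> x"
      using r x unfolding chain_retraction_def by blast
    have "f k (f' k (g' k (g k x))) = f k (bdry C' (k + 1) y') \<oplus>\<^bsub>chain_space C k\<^esub> f k (g k x)"
      using y' lin d' cycles_carrier[OF gx] by simp
    also have "\<dots> = bdry C (k + 1) (f (k + 1) y') \<oplus>\<^bsub>chain_space C k\<^esub> (bdry C (k + 1) y \<oplus>\<^bsub>chain_space C k\<^esub> x)"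
      using y y' chain_mapD(3)[OF m(1)] by simp
    also have "\<dots> = bdry C (k + 1) (f (k + 1) y' \<oplus>\<^bsub>chain_space C (k + 1)\<^esub> y) \<oplus>\<^bsub>chain_space C k\<^esub> x"
      using y(1) y'(1) d lin cycles_carrier[OF x] V.a_assoc by simp
    finally show ?thesis
      using y(1) y'(1) lin
      by (intro bexI[of _ "f (k + 1) y' \<oplus>\<^bsub>chain_space C (k + 1)\<^esub> y"]) auto
  qed
  moreover have "chain_map C'' C (f \<circ>\<^sub>g f')" "chain_map C C'' (g' \<circ>\<^sub>g g)"
    using chain_map_comp m by blast+
  moreover have "g' k (g k (f k (f' k x))) = x" if "x \<in> carrier (chain_space C'' k)" for k x
    using r r' that lin unfolding chain_retraction_def by simp
  ultimately show ?thesis unfolding chain_retraction_def by (simp add: graded_comp_def)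
qed

text \<open>Any choice \<open>R\<close> of retracts with zero boundaries computes homology, naturally in the complex.\<close>

context
  fixes R :: "('k::field, 'v) chain_complex \<Rightarrow> ('k, 'v) chain_complex"
    and f g :: "('k, 'v) chain_complex \<Rightarrow> int \<Rightarrow> 'v \<Rightarrow> 'v"
  assumes fd: "\<And>C. fd_chain_complex C \<Longrightarrow> fd_chain_complex (R C)"
    and zb: "\<And>C. fd_chain_complex C \<Longrightarrow> zero_boundaries (R C)"
    and retr: "\<And>C. fd_chain_complex C \<Longrightarrow> chain_retraction C (R C) (f C) (g C)"
begin

lemma retraction_maps:
  assumes "fd_chain_complex C"
  shows "chain_map (R C) C (f C)" "chain_map C (R C) (g C)"
    and "x \<in> carrier (chain_space (R C) k) \<Longrightarrow> g C k (f C k x) = x"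
    and "x \<in> cycles C k \<Longrightarrow> \<exists>y\<in>carrier (chain_space C (k + 1)).
        f C k (g C k x) = bdry C (k + 1) y \<oplus>\<^bsub>chain_space C k\<^esub> x"
  using retr[OF assms] unfolding chain_retraction_def by blast+

lemma retract_cycles:
  assumes "fd_chain_complex C"
  shows "cycles (R C) k = carrier (chain_space (R C) k)"
  using zb[OF assms] by (auto simp: cycles_def zero_boundaries_def)

text \<open>The chain map \<open>g C\<close> sends boundaries to boundaries, and \<open>R C\<close> has only zero ones.\<close>

lemma retract_kills_boundary:
  assumes C: "fd_chain_complex C" and y: "y \<in> carrier (chain_space C (k + 1))" and x: "x \<in> carrier (chain_space C k)"
  shows "g C k (bdry C (k + 1) y \<oplus>\<^bsub>chain_space C k\<^esub> x) = g C k x"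
proof -
  note m = retraction_maps[OF C]
  note g = linear_mapD[OF chain_mapD(1)[OF m(2)]]
  interpret V: vectorspace class_ring "chain_space (R C) k" by (rule fd_chain_complexD(1)[OF fd[OF C]])
  have "bdry (R C) (k + 1) (g C (k + 1) y) = \<zero>\<^bsub>chain_space (R C) (k + 1 - 1)\<^esub>"
    using zb[OF C] g(3)[OF y] unfolding zero_boundaries_def by blast
  then have "g C k (bdry C (k + 1) y) = \<zero>\<^bsub>chain_space (R C) k\<^esub>"
    using chain_mapD(3)[OF m(2) y] by simp
  then show ?thesis
    using x y g linear_mapD(3)[OF fd_chain_complexD(4)[OF C, of k]] by simp
qed

text \<open>This is the source of functoriality: between two chain maps, the idempotent \<open>f \<circ> g\<close> changes a cycle
  only by a boundary, which the last map kills.\<close>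

lemma retract_absorbs:
  assumes C: "fd_chain_complex C" and D: "fd_chain_complex D" and \<psi>: "chain_map C D \<psi>"
    and z: "z \<in> cycles C k"
  shows "g D k (\<psi> k (f C k (g C k z))) = g D k (\<psi> k z)"
proof -
  note p = linear_mapD[OF chain_mapD(1)[OF \<psi>]] and d = linear_mapD[OF fd_chain_complexD(4)[OF C, of k]]
  obtain y where y: "y \<in> carrier (chain_space C (k + 1))"
      "f C k (g C k z) = bdry C (k + 1) y \<oplus>\<^bsub>chain_space C k\<^esub> z"
    using retraction_maps(4)[OF C z] by blast
  then have "\<psi> k (f C k (g C k z)) = bdry D (k + 1) (\<psi> (k + 1) y) \<oplus>\<^bsub>chain_space D k\<^esub> \<psi> k z"
    using p d cycles_carrier[OF z] chain_mapD(3)[OF \<psi>] by simp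
  then show ?thesis
    using retract_kills_boundary[OF D] p(3) y(1) cycles_carrier[OF z] by simp
qed

lemma retract_graded_functor:
  "graded_functor (\<lambda>C. chain_space (R C)) (\<lambda>C D \<phi>. g D \<circ>\<^sub>g \<phi> \<circ>\<^sub>g f C)"
  unfolding graded_functor_def
proof (intro conjI allI impI; (elim conjE)?)
  fix C D E :: "('k, 'v) chain_complex" and \<phi> \<psi> :: "int \<Rightarrow> 'v \<Rightarrow> 'v"
  assume C: "fd_chain_complex C"
  note mC = retraction_maps[OF C]
  show "graded_space (chain_space (R C))"
    using fd_chain_complexD(1)[OF fd[OF C]] by (simp add: graded_space_def)
  show "graded_eq (chain_space (R C)) (g C \<circ>\<^sub>g graded_id \<circ>\<^sub>g f C) graded_id"
    using mC(3) by (simp add: graded_eq_def graded_comp_def graded_id_def)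
  assume D: "fd_chain_complex D" and \<phi>: "chain_map C D \<phi>"
  note mD = retraction_maps[OF D]
  show "graded_map (chain_space (R C)) (chain_space (R D)) (g D \<circ>\<^sub>g \<phi> \<circ>\<^sub>g f C)"
    using chain_map_comp[OF mC(1) chain_map_comp[OF \<phi> mD(2)]] by (simp add: chain_map_def)
  show "graded_eq (chain_space (R C)) (g D \<circ>\<^sub>g \<phi> \<circ>\<^sub>g f C) (g D \<circ>\<^sub>g \<psi> \<circ>\<^sub>g f C)"
    if "graded_eq (chain_space C) \<phi> \<psi>"
    using that linear_mapD(3)[OF chain_mapD(1)[OF mC(1)]] by (simp add: graded_eq_def graded_comp_def)
  assume E: "fd_chain_complex E" and \<psi>: "chain_map D E \<psi>"
  have "\<phi> k (f C k x) \<in> cycles D k" if "x \<in> carrier (chain_space (R C) k)" for k x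
    using that chain_map_cycles[OF \<phi>] chain_map_cycles[OF mC(1)] retract_cycles[OF C] by simp
  then show "graded_eq (chain_space (R C)) (g E \<circ>\<^sub>g (\<psi> \<circ>\<^sub>g \<phi>) \<circ>\<^sub>g f C)
      (g E \<circ>\<^sub>g \<psi> \<circ>\<^sub>g f D \<circ>\<^sub>g (g D \<circ>\<^sub>g \<phi> \<circ>\<^sub>g f C))"
    using retract_absorbs[OF D E \<psi>] by (simp add: graded_eq_def graded_comp_def)
qed

text \<open>Injectivity: if \<open>f x\<close> and \<open>f y\<close> differ by a boundary, then applying \<open>g\<close> gives \<open>x = y\<close>.
  Surjectivity: the class of \<open>z\<close> is hit by \<open>g z\<close>, because \<open>f (g z)\<close> is homologous to \<open>z\<close>.\<close>

lemma retract_graded_iso_homology: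
  assumes C: "fd_chain_complex C"
  shows "graded_iso (chain_space (R C)) (homology C) (\<lambda>k x. hclass C k (f C k x))"
  unfolding graded_iso_def graded_map_def bij_betw_def
proof (intro conjI allI)
  fix k
  note m = retraction_maps[OF C]
  note fl = linear_mapD[OF chain_mapD(1)[OF m(1), of k]]
    and h = linear_mapD[OF homology_hclass(2)[OF C, of k]]
  have cyc: "f C k x \<in> cycles C k" if "x \<in> carrier (chain_space (R C) k)" for x
    using that chain_map_cycles[OF m(1)] retract_cycles[OF C] by simp
  show "linear_map class_ring (chain_space (R C) k) (homology C k) (\<lambda>x. hclass C k (f C k x))"
    by (rule linear_mapI) (use fl h cyc in auto)
  show "inj_on (\<lambda>x. hclass C k (f C k x)) (carrier (chain_space (R C) k))"
  proof (rule inj_onI)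
    fix x y assume x: "x \<in> carrier (chain_space (R C) k)" and y: "y \<in> carrier (chain_space (R C) k)"
      and eq: "hclass C k (f C k x) = hclass C k (f C k y)"
    obtain z where "z \<in> carrier (chain_space C (k + 1))" "f C k x = bdry C (k + 1) z \<oplus>\<^bsub>chain_space C k\<^esub> f C k y"
      using eq homology_hclass(4)[OF C cyc[OF x] cyc[OF y]] by auto
    then have "g C k (f C k x) = g C k (f C k y)"
      using retract_kills_boundary[OF C] fl(3)[OF y] by simp
    then show "x = y" using m(3) x y by simp
  qed
  have "X \<in> (\<lambda>x. hclass C k (f C k x)) ` carrier (chain_space (R C) k)"
    if X: "X \<in> carrier (homology C k)" for X
  proof -
    obtain z where z: "z \<in> cycles C k" "X = hclass C k z"
      using X by (auto simp: homology_hclass(3)[OF C])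
    have gz: "g C k z \<in> carrier (chain_space (R C) k)"
      using linear_mapD(3)[OF chain_mapD(1)[OF m(2)]] cycles_carrier[OF z(1)] by simp
    have "hclass C k (f C k (g C k z)) = hclass C k z"
      using homology_hclass(4)[OF C cyc[OF gz] z(1)] m(4)[OF z(1)] by simp
    then show ?thesis using gz z(2) by auto
  qed
  then show "(\<lambda>x. hclass C k (f C k x)) ` carrier (chain_space (R C) k) = carrier (homology C k)"
    using cyc by (auto simp: homology_hclass(3)[OF C])
qed

text \<open>Both ways round the naturality square end in the class of \<open>\<phi> (f x)\<close>, since \<open>f \<circ> g\<close> preserves
  the classes of cycles.\<close>

lemma retract_naturally_isomorphic_homology:
  "naturally_isomorphic (\<lambda>C. chain_space (R C)) (\<lambda>C D \<phi>. g D \<circ>\<^sub>g \<phi> \<circ>\<^sub>g f C) homology homology_map"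
  unfolding naturally_isomorphic_def
proof (intro exI[of _ "\<lambda>C k x. hclass C k (f C k x)"] conjI allI impI; (elim conjE)?)
  fix C D :: "('k, 'v) chain_complex" and \<phi> :: "int \<Rightarrow> 'v \<Rightarrow> 'v"
  assume C: "fd_chain_complex C"
  show "graded_iso (chain_space (R C)) (homology C) (\<lambda>k x. hclass C k (f C k x))"
    by (rule retract_graded_iso_homology[OF C])
  assume D: "fd_chain_complex D" and \<phi>: "chain_map C D \<phi>"
  have "hclass D k (f D k (g D k (\<phi> k (f C k x)))) = homology_map C D \<phi> k (hclass C k (f C k x))"
    if x: "x \<in> carrier (chain_space (R C) k)" for k x
  proof -
    have c: "f C k x \<in> cycles C k"
      using x chain_map_cycles[OF retraction_maps(1)[OF C]] retract_cycles[OF C] by simp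
    let ?z = "\<phi> k (f C k x)"
    have z: "?z \<in> cycles D k" using chain_map_cycles[OF \<phi> c] .
    have "f D k (g D k ?z) \<in> cycles D k"
      by (rule chain_map_cycles[OF retraction_maps(1)[OF D] chain_map_cycles[OF retraction_maps(2)[OF D] z]])
    then have "hclass D k (f D k (g D k ?z)) = hclass D k ?z"
      using homology_hclass(4)[OF D _ z] retraction_maps(4)[OF D z] by blast
    then show ?thesis using homology_map_hclass[OF C D \<phi> c] by simp
  qed
  then show "graded_eq (chain_space (R C)) ((\<lambda>k x. hclass D k (f D k x)) \<circ>\<^sub>g (g D \<circ>\<^sub>g \<phi> \<circ>\<^sub>g f C))
      (homology_map C D \<phi> \<circ>\<^sub>g (\<lambda>k x. hclass C k (f C k x)))"
    by (simp add: graded_eq_def graded_comp_def)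
qed

end

section \<open>The algebra of a contraction\<close>

text \<open>The properties of a Morse matching that make its reduction work, free of graphs and bases.  In the
  application \<open>S k\<close> and \<open>T k\<close> are the spans of the critical vectors and of the sources of matched
  edges, \<open>p\<close> projects to \<open>S k\<close> along the matched basis vectors, and \<open>h\<close> sums over the paths that gain
  one degree.  Assumption \<open>h_bdry\<close> says that \<open>- h\<close> undoes the boundary on \<open>T k\<close>, and \<open>split\<close> that
  \<open>x + d (h x)\<close> has no component along the targets.  Differences are avoided in favour of sums, as the
  negative in a module depends on its carrier, which changes when passing to a subspace.\<close>

locale matching_contraction =
  fixes C :: "('k::field, 'v) chain_complex"
    and S T :: "int \<Rightarrow> 'v set" and h p :: "int \<Rightarrow> 'v \<Rightarrow> 'v"
  assumes fd: "fd_chain_complex C"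
    and S_sub: "submodule class_ring (S k) (chain_space C k)"
    and S_fin: "vectorspace.fin_dim class_ring ((chain_space C k)\<lparr>carrier := S k\<rparr>)"
    and T_sub: "T k \<subseteq> carrier (chain_space C k)"
    and h_lin: "linear_map class_ring (chain_space C k) (chain_space C (k + 1)) (h k)"
    and p_lin: "linear_map class_ring (chain_space C k) (chain_space C k) (p k)"
    and h_in: "x \<in> carrier (chain_space C k) \<Longrightarrow> h k x \<in> T (k + 1)"
    and h_S: "x \<in> S k \<Longrightarrow> h k x = \<zero>\<^bsub>chain_space C (k + 1)\<^esub>"
    and h_T: "x \<in> T k \<Longrightarrow> h k x = \<zero>\<^bsub>chain_space C (k + 1)\<^esub>"
    and h_bdry: "x \<in> T k \<Longrightarrow> x \<oplus>\<^bsub>chain_space C k\<^esub> h (k - 1) (bdry C k x) = \<zero>\<^bsub>chain_space C k\<^esub>"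
    and p_in: "x \<in> carrier (chain_space C k) \<Longrightarrow> p k x \<in> S k"
    and p_S: "x \<in> S k \<Longrightarrow> p k x = x"
    and p_T: "x \<in> T k \<Longrightarrow> p k x = \<zero>\<^bsub>chain_space C k\<^esub>"
    and split: "x \<in> carrier (chain_space C k) \<Longrightarrow> \<exists>a\<in>T k. x \<oplus>\<^bsub>chain_space C k\<^esub> bdry C (k + 1) (h k x) =
        p k (x \<oplus>\<^bsub>chain_space C k\<^esub> bdry C (k + 1) (h k x)) \<oplus>\<^bsub>chain_space C k\<^esub> a"
begin

abbreviation "V \<equiv> chain_space C"
abbreviation "d \<equiv> bdry C"

definition incl :: "int \<Rightarrow> 'v \<Rightarrow> 'v" where
  "incl k x = x \<oplus>\<^bsub>V k\<^esub> h (k - 1) (d k x)"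

definition proj :: "int \<Rightarrow> 'v \<Rightarrow> 'v" where
  "proj k x = p k (x \<oplus>\<^bsub>V k\<^esub> d (k + 1) (h k x))"

sublocale V: vectorspace class_ring "V k" for k
  by (rule fd_chain_complexD(1)[OF fd])

lemmas d_maps = linear_mapD(3-6)[OF fd_chain_complexD(3)[OF fd]]
  and d1_maps = linear_mapD(3-6)[OF fd_chain_complexD(4)[OF fd]]
  and dd = fd_chain_complexD(5,6)[OF fd]
  and h_maps = linear_mapD(3-6)[OF h_lin]
  and p_maps = linear_mapD(3-6)[OF p_lin]

lemma hm_lin: "linear_map class_ring (V (k - 1)) (V k) (h (k - 1))"
  using h_lin[of "k - 1"] by simp

lemmas hm_maps = linear_mapD(3-6)[OF hm_lin]

lemma hm_in: "x \<in> carrier (V (k - 1)) \<Longrightarrow> h (k - 1) x \<in> T k"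
  using h_in[of x "k - 1"] by simp

lemma S_carrier: "x \<in> S k \<Longrightarrow> x \<in> carrier (V k)"
  using S_sub[of k] by (auto simp: submodule_def)

lemma T_carrier: "x \<in> T k \<Longrightarrow> x \<in> carrier (V k)"
  using T_sub[of k] by auto

lemma incl_lin: "linear_map class_ring (V k) (V k) (incl k)"
  unfolding incl_def[abs_def]
  by (intro linear_map_add linear_map_id V.vectorspace_axioms
      linear_map_comp[OF fd_chain_complexD(3)[OF fd] hm_lin])

lemma proj_lin: "linear_map class_ring (V k) (V k) (proj k)"
  unfolding proj_def[abs_def]
  by (intro linear_map_add linear_map_id V.vectorspace_axioms
      linear_map_comp[OF h_lin fd_chain_complexD(4)[OF fd]] linear_map_comp[OF _ p_lin])

lemmas incl_maps = linear_mapD(3-6)[OF incl_lin]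
  and proj_maps = linear_mapD(3-6)[OF proj_lin]

lemma proj_in: "x \<in> carrier (V k) \<Longrightarrow> proj k x \<in> S k"
  unfolding proj_def using d1_maps h_maps p_in by auto

text \<open>The correction \<open>h (d x)\<close> lies in \<open>T k\<close>, where both \<open>h\<close> and \<open>p\<close> vanish.\<close>

lemma proj_incl:
  assumes "x \<in> S k" shows "proj k (incl k x) = x"
proof -
  have x: "x \<in> carrier (V k)" using S_carrier assms .
  then have hd: "h (k - 1) (d k x) \<in> T k" "h (k - 1) (d k x) \<in> carrier (V k)"
    using hm_in d_maps hm_maps by auto
  have "h k (incl k x) = \<zero>\<^bsub>V (k + 1)\<^esub>"
    unfolding incl_def using h_maps x hd h_S[OF assms] h_T[OF hd(1)] by simp
  then have "proj k (incl k x) = p k (incl k x)"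
    unfolding proj_def using d1_maps incl_maps x by simp
  also have "\<dots> = x"
    unfolding incl_def using p_maps x hd p_S[OF assms] p_T[OF hd(1)] by simp
  finally show ?thesis .
qed

text \<open>By \<open>h_bdry\<close>, \<open>d a + d (h (d a)) = d (a + h (d a)) = d 0\<close>.\<close>

lemma proj_T_boundary:
  assumes "a \<in> T k" shows "proj (k - 1) (d k a) = \<zero>\<^bsub>V (k - 1)\<^esub>"
proof -
  have a: "a \<in> carrier (V k)" using T_carrier assms .
  have "d k a \<oplus>\<^bsub>V (k - 1)\<^esub> d k (h (k - 1) (d k a)) = d k (a \<oplus>\<^bsub>V k\<^esub> h (k - 1) (d k a))"
    using a d_maps hm_maps by simp
  also have "\<dots> = \<zero>\<^bsub>V (k - 1)\<^esub>" using h_bdry[OF assms] d_maps by simp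
  finally show ?thesis unfolding proj_def using p_maps by simp
qed

lemma split_proj:
  assumes "x \<in> carrier (V k)"
  obtains a where "a \<in> T k" "x \<oplus>\<^bsub>V k\<^esub> d (k + 1) (h k x) = proj k x \<oplus>\<^bsub>V k\<^esub> a"
  using split[OF assms] unfolding proj_def by blast

text \<open>On all chains the identity is \<open>f g = 1 + d h + h d\<close>; its restriction to cycles is enough.  Write
  \<open>x + d (h x) = proj x + a\<close> with \<open>a \<in> T k\<close>.  The left side is a cycle, so \<open>h d\<close> kills the right
  side, and \<open>h (d a) = - a\<close> forces \<open>h (d (proj x)) = a\<close>.  So passing from \<open>proj x\<close> to
  \<open>incl (proj x)\<close> restores exactly the part \<open>a\<close> that \<open>p\<close> has dropped.\<close>

lemma incl_proj_cycle:
  assumes x: "x \<in> carrier (V k)" and cyc: "d k x = \<zero>\<^bsub>V (k - 1)\<^esub>"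
  shows "incl k (proj k x) = d (k + 1) (h k x) \<oplus>\<^bsub>V k\<^esub> x"
proof -
  obtain a where a: "a \<in> T k" and eq: "x \<oplus>\<^bsub>V k\<^esub> d (k + 1) (h k x) = proj k x \<oplus>\<^bsub>V k\<^esub> a"
    using split_proj[OF x] .
  have c: "a \<in> carrier (V k)" "proj k x \<in> carrier (V k)" "h k x \<in> carrier (V (k + 1))"
    "d (k + 1) (h k x) \<in> carrier (V k)"
    using T_carrier[OF a] proj_maps h_maps d1_maps x by auto
  let ?H = "\<lambda>x. h (k - 1) (d k x)"
  have H: "?H y \<in> carrier (V k)" if "y \<in> carrier (V k)" for y
    using that d_maps hm_maps by simp
  have "d k (x \<oplus>\<^bsub>V k\<^esub> d (k + 1) (h k x)) = \<zero>\<^bsub>V (k - 1)\<^esub>"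
    using d_maps(2)[OF x c(4)] cyc dd(2)[OF c(3)] by simp
  then have "?H (proj k x \<oplus>\<^bsub>V k\<^esub> a) = \<zero>\<^bsub>V k\<^esub>"
    unfolding eq using hm_maps by simp
  then have "?H (proj k x) \<oplus>\<^bsub>V k\<^esub> ?H a = \<zero>\<^bsub>V k\<^esub>"
    using c d_maps hm_maps by simp
  moreover have "a \<oplus>\<^bsub>V k\<^esub> ?H a = \<zero>\<^bsub>V k\<^esub>" by (rule h_bdry[OF a])
  ultimately have "?H (proj k x) = a"
    using V.add.right_cancel[of "?H a" k "?H (proj k x)" a] H c by simp
  then show ?thesis unfolding incl_def using eq x c V.a_comm by simp
qed

text \<open>The vectors \<open>x + d (h x)\<close> and \<open>proj x\<close> differ by an element of \<open>T k\<close>, whose boundary \<open>proj\<close> kills,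
  and \<open>x + d (h x)\<close> has the same boundary as \<open>x\<close>.\<close>

lemma proj_bdry_proj:
  assumes x: "x \<in> carrier (V k)"
  shows "proj (k - 1) (d k (proj k x)) = proj (k - 1) (d k x)"
proof -
  obtain a where a: "a \<in> T k" and eq: "x \<oplus>\<^bsub>V k\<^esub> d (k + 1) (h k x) = proj k x \<oplus>\<^bsub>V k\<^esub> a"
    using split_proj[OF x] .
  have c: "a \<in> carrier (V k)" "proj k x \<in> carrier (V k)" "h k x \<in> carrier (V (k + 1))"
    "d (k + 1) (h k x) \<in> carrier (V k)"
    using T_carrier[OF a] proj_maps h_maps d1_maps x by auto
  have "proj (k - 1) (d k (proj k x)) = proj (k - 1) (d k (proj k x \<oplus>\<^bsub>V k\<^esub> a))"
    using c proj_T_boundary[OF a] d_maps proj_maps by simp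
  also have "\<dots> = proj (k - 1) (d k (x \<oplus>\<^bsub>V k\<^esub> d (k + 1) (h k x)))" by (simp add: eq)
  also have "\<dots> = proj (k - 1) (d k x)"
    using x c dd(2)[OF c(3)] d_maps by simp
  finally show ?thesis .
qed

text \<open>A reduced complex is only assumed to have the right values on its carriers, because it is defined
  by linear extension, which is arbitrary elsewhere.  That \<open>f\<close> is a chain map is \<open>incl_proj_cycle\<close> for
  the cycle \<open>d x\<close>; that \<open>g\<close> is one, and that the new boundary squares to zero, is \<open>proj_bdry_proj\<close>.\<close>

lemma reduced_retraction:
  assumes sp: "\<And>k. chain_space C' k = (V k)\<lparr>carrier := S k\<rparr>"
    and b: "\<And>k x. x \<in> S k \<Longrightarrow> bdry C' k x = proj (k - 1) (d k x)"
    and f: "\<And>k x. x \<in> S k \<Longrightarrow> f k x = incl k x"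
    and g: "\<And>k x. x \<in> carrier (V k) \<Longrightarrow> g k x = proj k x"
  shows "fd_chain_complex C'" and "chain_retraction C C' f g"
proof -
  have self: "submodule class_ring (carrier (V k)) (V k)" for k
    using V.module_axioms by (auto simp: submodule_def)
  have VS: "vectorspace class_ring ((V k)\<lparr>carrier := S k\<rparr>)" for k
    by (intro V.subspace_is_vs subspace.intro S_sub V.vectorspace_axioms)
  have bl: "linear_map class_ring ((V k)\<lparr>carrier := S k\<rparr>) ((V (k - 1))\<lparr>carrier := S (k - 1)\<rparr>) (bdry C' k)" for k
    by (rule linear_map_cong[OF linear_map_subspace[OF
          linear_map_comp[OF fd_chain_complexD(3)[OF fd] proj_lin] S_sub S_sub]])
      (use b S_carrier d_maps proj_in in auto)
  have fl: "linear_map class_ring ((V k)\<lparr>carrier := S k\<rparr>) (V k) (f k)" for k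
    using linear_map_cong[OF linear_map_subspace[OF incl_lin S_sub self], of k "f k"]
      f S_carrier incl_maps by auto
  have gl: "linear_map class_ring (V k) ((V k)\<lparr>carrier := S k\<rparr>) (g k)" for k
    using linear_map_cong[OF linear_map_subspace[OF proj_lin self S_sub], of k "g k"]
      g proj_in by auto
  have bb: "bdry C' k (bdry C' (k + 1) x) = \<zero>\<^bsub>V (k - 1)\<^esub>" if x: "x \<in> S (k + 1)" for k x
  proof -
    have "bdry C' (k + 1) x = proj k (d (k + 1) x)" "d (k + 1) x \<in> carrier (V k)"
      using b[OF x] d1_maps S_carrier[OF x] by simp_all
    then show ?thesis
      using b[of "proj k (d (k + 1) x)" k] proj_in proj_bdry_proj dd(2)[OF S_carrier[OF x]]
        proj_maps by simp
  qed
  obtain N :: nat where N: "\<forall>k. k < 0 \<or> k > int N \<longrightarrow> carrier (V k) = {\<zero>\<^bsub>V k\<^esub>}"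
    using fd by (auto simp: fd_chain_complex_def)
  have "\<zero>\<^bsub>V k\<^esub> \<in> S k" for k using S_sub by (auto simp: submodule_def)
  then have N': "\<forall>k. k < 0 \<or> k > int N \<longrightarrow> S k = {\<zero>\<^bsub>V k\<^esub>}"
    using N S_carrier by blast
  show "fd_chain_complex C'"
    unfolding fd_chain_complex_def using VS S_fin bl bb N'
    by (intro conjI exI[of _ N]) (auto simp: sp)
  have "chain_map C' C f"
    unfolding chain_map_def graded_map_def
  proof (intro conjI allI ballI)
    show "linear_map class_ring (chain_space C' k) (V k) (f k)" for k
      using fl by (simp add: sp)
    fix k x assume "x \<in> carrier (chain_space C' k)"
    then have x: "x \<in> S k" "x \<in> carrier (V k)" using S_carrier by (auto simp: sp)
    have dx: "d k x \<in> carrier (V (k - 1))" "d (k - 1) (d k x) = \<zero>\<^bsub>V (k - 1 - 1)\<^esub>"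
      using d_maps x dd(1) by auto
    have "f (k - 1) (bdry C' k x) = incl (k - 1) (proj (k - 1) (d k x))"
      using b[OF x(1)] f proj_in[OF dx(1)] by simp
    also have "\<dots> = d k (h (k - 1) (d k x)) \<oplus>\<^bsub>V (k - 1)\<^esub> d k x"
      using incl_proj_cycle[OF dx] by simp
    also have "\<dots> = d k (incl k x)"
      unfolding incl_def using x dx d_maps hm_maps V.a_comm by simp
    finally show "d k (f k x) = f (k - 1) (bdry C' k x)" using f x by simp
  qed
  moreover have "chain_map C C' g"
    unfolding chain_map_def graded_map_def
    using gl proj_bdry_proj b g proj_in d_maps by (auto simp: sp)
  moreover have "\<exists>y\<in>carrier (V (k + 1)). f k (g k x) = d (k + 1) y \<oplus>\<^bsub>V k\<^esub> x"
    if "x \<in> cycles C k" for k x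
    using that incl_proj_cycle[of x k] f g proj_in h_maps by (auto simp: cycles_def)
  ultimately show "chain_retraction C C' f g"
    unfolding chain_retraction_def using f g proj_incl incl_maps S_carrier by (auto simp: sp)
qed

end

section \<open>Sums over paths in a finite acyclic digraph\<close>

locale acyclic_weighted_digraph = fin_digraph G for G :: "('a, 'b) pre_digraph" (structure) +
  fixes w :: "'b \<Rightarrow> 'k::comm_ring_1"
  assumes no_cycle: "\<not> cycle p"
begin

definition path_total :: "'a \<Rightarrow> 'a \<Rightarrow> 'k" where
  "path_total a b = (\<Sum>\<gamma> | apath a \<gamma> b. prod_list (map w \<gamma>))"

lemma closed_awalk_Nil: "awalk a p a \<Longrightarrow> p = []"
  using closed_w_imp_cycle[of p] no_cycle by (auto simp: closed_w_def)

text \<open>A repeated vertex would close a cycle.  Walks, unlike paths, can be extended at either end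
  without a side condition, which is what the two recursions below need.\<close>

lemma apath_iff_awalk: "apath a p b \<longleftrightarrow> awalk a p b"
proof
  show "awalk a p b \<Longrightarrow> apath a p b"
  proof (induction p arbitrary: a)
    case (Cons e es)
    then have e: "e \<in> arcs G" "a = tail G e" "awalk (head G e) es b" by (auto simp: awalk_Cons_iff)
    have "a \<notin> set (awalk_verts (head G e) es)"
    proof
      assume "a \<in> set (awalk_verts (head G e) es)"
      then obtain q where "awalk (head G e) q a" using awalk_decomp[OF e(3)] by blast
      then have "awalk a (e # q) a" using e by (simp add: awalk_Cons_iff)
      then show False using closed_awalk_Nil by blast
    qed
    then show ?case using Cons e by (simp add: apath_Cons_iff)
  qed (simp add: awalk_Nil_iff apath_Nil_iff)
qed (simp add: apath_def)

lemma finite_awalks: "finite {\<gamma>. awalk a \<gamma> b}"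
  using apaths_finite[of a b] by (simp add: apath_iff_awalk)

lemma path_total_split:
  assumes "a \<in> verts G"
  shows "path_total a b = (if a = b then 1 else 0) + (\<Sum>\<gamma> | awalk a \<gamma> b \<and> \<gamma> \<noteq> []. prod_list (map w \<gamma>))"
proof -
  let ?N = "{\<gamma>. awalk a \<gamma> b \<and> \<gamma> = []}" and ?S = "{\<gamma>. awalk a \<gamma> b \<and> \<gamma> \<noteq> []}"
  have "finite ?N" "finite ?S" "?N \<inter> ?S = {}"
    by (auto intro: finite_subset[OF _ finite_awalks[of a b]])
  moreover have "{\<gamma>. apath a \<gamma> b} = ?N \<union> ?S" unfolding apath_iff_awalk by blast
  ultimately have "path_total a b = (\<Sum>\<gamma>\<in>?N. prod_list (map w \<gamma>)) + (\<Sum>\<gamma>\<in>?S. prod_list (map w \<gamma>))"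
    unfolding path_total_def by (simp only: sum.union_disjoint)
  moreover have "{\<gamma>. awalk a \<gamma> b \<and> \<gamma> = []} = (if a = b then {[]} else {})"
    using assms by (auto simp: awalk_Nil_iff)
  ultimately show ?thesis by (simp split: if_splits)
qed

text \<open>With \<open>N\<close> the matrix of arc weights, this is \<open>P = 1 + N P\<close>.\<close>

lemma path_total_first_step:
  assumes "a \<in> verts G"
  shows "path_total a b = (if a = b then 1 else 0) +
    (\<Sum>e | e \<in> arcs G \<and> tail G e = a. w e * path_total (head G e) b)"
proof -
  let ?E = "{e \<in> arcs G. tail G e = a}" and ?W = "\<lambda>e. {\<gamma>. awalk (head G e) \<gamma> b}"
  have "{\<gamma>. awalk a \<gamma> b \<and> \<gamma> \<noteq> []} = (\<lambda>(e, \<gamma>). e # \<gamma>) ` (SIGMA e:?E. ?W e)"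
  proof (intro equalityI subsetI)
    fix p assume "p \<in> {\<gamma>. awalk a \<gamma> b \<and> \<gamma> \<noteq> []}"
    then show "p \<in> (\<lambda>(e, \<gamma>). e # \<gamma>) ` (SIGMA e:?E. ?W e)"
      by (cases p) (auto simp: awalk_Cons_iff image_iff)
  qed (auto simp: awalk_Cons_iff)
  moreover have "inj_on (\<lambda>(e, \<gamma>). e # \<gamma>) (SIGMA e:?E. ?W e)" by (auto simp: inj_on_def)
  ultimately have "(\<Sum>\<gamma> | awalk a \<gamma> b \<and> \<gamma> \<noteq> []. prod_list (map w \<gamma>)) =
      (\<Sum>(e, \<gamma>)\<in>(SIGMA e:?E. ?W e). w e * prod_list (map w \<gamma>))"
    by (simp add: sum.reindex case_prod_unfold)
  also have "\<dots> = (\<Sum>e\<in>?E. \<Sum>\<gamma>\<in>?W e. w e * prod_list (map w \<gamma>))"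
    by (rule sum.Sigma[symmetric]) (use finite_awalks in auto)
  finally show ?thesis
    using path_total_split[OF assms, of b]
    by (simp add: path_total_def apath_iff_awalk sum_distrib_left)
qed

lemma awalk_snoc_iff: "awalk a (\<gamma> @ [e]) b \<longleftrightarrow> awalk a \<gamma> (tail G e) \<and> e \<in> arcs G \<and> head G e = b"
proof
  assume "awalk a (\<gamma> @ [e]) b"
  then have *: "awalk a \<gamma> (awlast a \<gamma>) \<and> awalk (awlast a \<gamma>) [e] b"
    by (rule awalk_append_iff[THEN iffD1])
  then have **: "e \<in> arcs G \<and> awlast a \<gamma> = tail G e \<and> awalk (head G e) [] b"
    by (intro awalk_Cons_iff[THEN iffD1]) (rule conjunct2)
  then have "head G e = b" using awalk_empty_ends by simp
  with * ** show "awalk a \<gamma> (tail G e) \<and> e \<in> arcs G \<and> head G e = b" by simp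
next
  assume *: "awalk a \<gamma> (tail G e) \<and> e \<in> arcs G \<and> head G e = b"
  then have "awalk (tail G e) [e] b" using arc_implies_awalk[of e] by simp
  with * show "awalk a (\<gamma> @ [e]) b"
    using awalk_appendI[of a \<gamma> "tail G e" "[e]" b] by simp
qed

text \<open>This is \<open>P = 1 + P N\<close>.\<close>

lemma path_total_last_step:
  assumes "a \<in> verts G"
  shows "path_total a b = (if a = b then 1 else 0) +
    (\<Sum>e | e \<in> arcs G \<and> head G e = b. path_total a (tail G e) * w e)"
proof -
  let ?E = "{e \<in> arcs G. head G e = b}" and ?W = "\<lambda>e. {\<gamma>. awalk a \<gamma> (tail G e)}"
  have "{\<gamma>. awalk a \<gamma> b \<and> \<gamma> \<noteq> []} = (\<lambda>(e, \<gamma>). \<gamma> @ [e]) ` (SIGMA e:?E. ?W e)"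
  proof (intro equalityI subsetI)
    fix p assume p: "p \<in> {\<gamma>. awalk a \<gamma> b \<and> \<gamma> \<noteq> []}"
    then obtain \<gamma> e where pe: "p = \<gamma> @ [e]" by (cases p rule: rev_cases) auto
    then have "awalk a \<gamma> (tail G e)" "e \<in> ?E"
      using p awalk_snoc_iff[of a \<gamma> e b] by simp_all
    then show "p \<in> (\<lambda>(e, \<gamma>). \<gamma> @ [e]) ` (SIGMA e:?E. ?W e)"
      using pe by (intro image_eqI[of _ _ "(e, \<gamma>)"]) simp_all
  next
    fix p assume "p \<in> (\<lambda>(e, \<gamma>). \<gamma> @ [e]) ` (SIGMA e:?E. ?W e)"
    then obtain e \<gamma> where "p = \<gamma> @ [e]" "e \<in> ?E" "awalk a \<gamma> (tail G e)"
      by (auto simp del: awalk_append_iff)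
    then show "p \<in> {\<gamma>. awalk a \<gamma> b \<and> \<gamma> \<noteq> []}" using awalk_snoc_iff[of a \<gamma> e b] by simp
  qed
  moreover have "inj_on (\<lambda>(e, \<gamma>). \<gamma> @ [e]) (SIGMA e:?E. ?W e)" by (auto simp: inj_on_def)
  ultimately have "(\<Sum>\<gamma> | awalk a \<gamma> b \<and> \<gamma> \<noteq> []. prod_list (map w \<gamma>)) =
      (\<Sum>(e, \<gamma>)\<in>(SIGMA e:?E. ?W e). prod_list (map w \<gamma>) * w e)"
    by (simp add: sum.reindex case_prod_unfold)
  also have "\<dots> = (\<Sum>e\<in>?E. \<Sum>\<gamma>\<in>?W e. prod_list (map w \<gamma>) * w e)"
    by (rule sum.Sigma[symmetric]) (use finite_awalks in auto)
  finally show ?thesis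
    using path_total_split[OF assms, of b]
    by (simp add: path_total_def apath_iff_awalk sum_distrib_right)
qed

lemma awalk_potential:
  fixes \<tau> :: "'a \<Rightarrow> int"
  assumes "\<And>e. e \<in> arcs G \<Longrightarrow> \<tau> (head G e) \<le> \<tau> (tail G e)" "awalk a p b"
  shows "\<tau> b \<le> \<tau> a"
  using assms(2)
proof (induction p arbitrary: a)
  case (Cons e es)
  then have "e \<in> arcs G \<and> a = tail G e \<and> awalk (head G e) es b"
    by (simp only: awalk_Cons_iff)
  then show ?case using assms(1)[of e] Cons.IH[of "head G e"] by simp
qed (simp add: awalk_Nil_iff)

text \<open>A function that no arc increases bounds what paths can reach.\<close>

lemma path_total_potential:
  fixes \<tau> :: "'a \<Rightarrow> int"
  assumes "\<And>e. e \<in> arcs G \<Longrightarrow> \<tau> (head G e) \<le> \<tau> (tail G e)" "path_total a b \<noteq> 0"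
  shows "\<tau> b \<le> \<tau> a"
proof -
  have "{\<gamma>. awalk a \<gamma> b} \<noteq> {}"
    using assms(2) sum.empty unfolding path_total_def apath_iff_awalk by metis
  then obtain \<gamma> where "awalk a \<gamma> b" by blast
  then show ?thesis using awalk_potential[of \<tau> a \<gamma> b] assms(1) by simp
qed

end

section \<open>Path sums of a Morse matching\<close>

text \<open>A complex with chosen bases.  Equations between chains are proved by comparing the coordinates
  \<open>cc\<close>, in which linear maps become finite sums over the field.\<close>

locale based_complex =
  fixes C :: "('k::field, 'v) chain_complex" and I :: "int \<Rightarrow> 'v set"
  assumes fd: "fd_chain_complex C"
    and bases: "vectorspace.basis class_ring (chain_space C k) (I k)"
begin

abbreviation "V \<equiv> chain_space C"
abbreviation "d \<equiv> bdry C"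
abbreviation "D \<equiv> bdry_entry C I"
abbreviation "cc k \<equiv> coord (V k) (I k)"

sublocale V: vectorspace class_ring "V k" for k
  by (rule fd_chain_complexD(1)[OF fd])

lemma finite_I: "finite (I k)"
  using bases[of k] fd_chain_complexD(2)[OF fd, of k] V.fin_dim_li_fin[of k "I k"]
  by (simp add: V.basis_def)

sublocale F: free_family "V k" "I k" for k
  using finite_I bases[of k] by unfold_locales (auto simp: V.basis_def)

lemma span_I: "V.span k (I k) = carrier (V k)"
  using bases[of k] by (simp add: V.basis_def)

lemma I_carrier: "v \<in> I k \<Longrightarrow> v \<in> carrier (V k)"
  using F.B_sub by auto

text \<open>Outside the range of the complex the spaces are zero, and the only basis of a zero space is
  empty.\<close>

lemma finite_vertices: "finite (SIGMA k:UNIV. I k)"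
proof -
  obtain N :: nat where N: "\<forall>k. k < 0 \<or> k > int N \<longrightarrow> carrier (V k) = {\<zero>\<^bsub>V k\<^esub>}"
    using fd by (auto simp: fd_chain_complex_def)
  have "I k = {}" if "k < 0 \<or> k > int N" for k
    using N that F.B_sub[of k] V.vs_zero_lin_dep[OF F.B_sub F.indpt, of k] by auto
  then have "(SIGMA k:UNIV. I k) \<subseteq> (SIGMA k:{0..int N}. I k)" by force
  then show ?thesis by (rule finite_subset) (use finite_I in auto)
qed

lemma carrier_span_I: "(V k)\<lparr>carrier := V.span k (I k)\<rparr> = V k"
  by (simp add: span_I)

lemma lin_ext_maps:
  assumes "\<And>v. v \<in> I k \<Longrightarrow> h v \<in> carrier (V l)"
  shows "linear_map class_ring (V k) (V l) (lin_ext (V k) (I k) (V l) h)"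
    and "v \<in> I k \<Longrightarrow> lin_ext (V k) (I k) (V l) h v = h v"
  using F.lin_ext_linear[of "V l" h k] F.lin_ext_basis[of "V l" h k v] assms V.vectorspace_axioms[of l]
  unfolding carrier_span_I by auto

definition part :: "int \<Rightarrow> 'v set \<Rightarrow> 'v \<Rightarrow> 'v" where
  "part k S = lin_ext (V k) (I k) (V k) (\<lambda>v. if v \<in> S then v else \<zero>\<^bsub>V k\<^esub>)"

lemma part_lin: "linear_map class_ring (V k) (V k) (part k S)"
  unfolding part_def by (rule lin_ext_maps) (auto dest: I_carrier)

lemmas d_maps = linear_mapD(3-6)[OF fd_chain_complexD(3)[OF fd]]
  and d1_maps = linear_mapD(3-6)[OF fd_chain_complexD(4)[OF fd]]
  and p_maps = linear_mapD(3-6)[OF part_lin]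

lemma coord_linear_I:
  assumes "linear_map class_ring (V k) (V l) T" "x \<in> carrier (V k)"
  shows "cc l (T x) y = (\<Sum>v\<in>I k. cc k x v * cc l (T v) y)"
  using F.coord_linear[OF assms(1) _ F.free_family_axioms span_I] assms(2) by (simp add: span_I)

lemma eq_coordsI:
  assumes "x \<in> carrier (V k)" "y \<in> carrier (V k)" "\<And>v. v \<in> I k \<Longrightarrow> cc k x v = cc k y v"
  shows "x = y"
  using F.span_eqI[of x k y] assms by (simp add: span_I)

lemma cc_add: "x \<in> carrier (V k) \<Longrightarrow> y \<in> carrier (V k) \<Longrightarrow> cc k (x \<oplus>\<^bsub>V k\<^esub> y) v = cc k x v + cc k y v"
  using F.coord_add[of x k y v] by (simp add: span_I)

lemma coord_bdry:
  assumes "x \<in> carrier (V k)"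
  shows "cc (k - 1) (d k x) u = (\<Sum>v\<in>I k. cc k x v * D k u v)"
  using coord_linear_I[OF fd_chain_complexD(3)[OF fd] assms, of u] by (simp add: bdry_entry_def)

lemma coord_part:
  assumes x: "x \<in> carrier (V k)" and S: "S \<subseteq> I k"
  shows "cc k (part k S x) y = (if y \<in> S then cc k x y else 0)"
proof -
  have b: "part k S v = (if v \<in> S then v else \<zero>\<^bsub>V k\<^esub>)" if "v \<in> I k" for v
    unfolding part_def by (rule lin_ext_maps(2)[OF _ that]) (auto dest: I_carrier)
  have "cc k (part k S x) y = (\<Sum>v\<in>I k. cc k x v * cc k (part k S v) y)"
    by (rule coord_linear_I[OF part_lin x])
  also have "\<dots> = (\<Sum>v\<in>I k. if v = y then (if y \<in> S then cc k x y else 0) else 0)"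
    by (rule sum.cong) (auto simp: b F.coord_basis F.coord_zero)
  finally show ?thesis using finite_I S by auto
qed

lemma span_sub_iff:
  assumes "S \<subseteq> I k"
  shows "x \<in> V.span k S \<longleftrightarrow> x \<in> carrier (V k) \<and> (\<forall>v\<in>I k - S. cc k x v = 0)"
  using F.span_subfamily_iff[OF assms, of x] by (simp add: span_I)

end

locale matched_complex = based_complex C I
  for C :: "('k::field, 'v) chain_complex" and I :: "int \<Rightarrow> 'v set" +
  fixes M :: "'v edge set"
  assumes matching: "morse_matching C I M"
begin

abbreviation "G \<equiv> with_proj (morse_graph C I M)"
abbreviation "w \<equiv> morse_weight C I M"

definition matched :: "int \<Rightarrow> 'v \<Rightarrow> 'v \<Rightarrow> bool" where
  "matched k v u \<longleftrightarrow> ((k, v), (k - 1, u)) \<in> M"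

definition sources :: "int \<Rightarrow> 'v set" where
  "sources k = {v \<in> I k. \<exists>u. matched k v u}"

definition targets :: "int \<Rightarrow> 'v set" where
  "targets k = {u \<in> I k. \<exists>v. matched (k + 1) v u}"

lemma M_sub: "M \<subseteq> parcs (complex_graph C I)"
  using matching by (simp add: morse_matching_def)

lemma M_cases:
  assumes "e \<in> M"
  obtains k v u where "e = ((k, v), (k - 1, u))" "matched k v u"
proof -
  have "e \<in> parcs (complex_graph C I)" using assms M_sub by blast
  then obtain k v u where "e = ((k, v), (k - 1, u))"
    unfolding complex_graph_def by auto
  then show thesis using that[of k v u] assms by (simp add: matched_def)
qed

lemma matchedD:
  assumes "matched k v u"
  shows "v \<in> I k" "u \<in> I (k - 1)" "D k u v \<noteq> 0"
proof -
  have "((k, v), (k - 1, u)) \<in> parcs (complex_graph C I)"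
    using assms M_sub unfolding matched_def by blast
  then show "v \<in> I k" "u \<in> I (k - 1)" "D k u v \<noteq> 0" by (auto simp: complex_graph_def)
qed

lemma matched_disjoint:
  assumes "e \<in> M" "e' \<in> M" "{fst e, snd e} \<inter> {fst e', snd e'} \<noteq> {}"
  shows "e = e'"
proof -
  have "\<forall>e\<in>M. \<forall>e'\<in>M. e \<noteq> e' \<longrightarrow> {fst e, snd e} \<inter> {fst e', snd e'} = {}"
    using matching by (simp add: morse_matching_def)
  then show ?thesis using assms by blast
qed

lemma matched_unique:
  shows "matched k v u \<Longrightarrow> matched k v u' \<Longrightarrow> u = u'"
    and "matched k v u \<Longrightarrow> matched k v' u \<Longrightarrow> v = v'"
    and "matched k v u \<Longrightarrow> \<not> matched (k + 1) v' v"
proof -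
  show "u = u'" if "matched k v u" "matched k v u'"
    using matched_disjoint[OF that[unfolded matched_def]] by simp
  show "v = v'" if "matched k v u" "matched k v' u"
    using matched_disjoint[OF that[unfolded matched_def]] by simp
  show "\<not> matched (k + 1) v' v" if m: "matched k v u"
  proof
    assume m': "matched (k + 1) v' v"
    show False using matched_disjoint[OF m[unfolded matched_def] m'[unfolded matched_def]] by simp
  qed
qed

lemma critical_iff: "critical I M k = I k - sources k - targets k"
proof -
  have src: "(\<exists>e\<in>M. (k, v) = fst e) \<longleftrightarrow> (\<exists>u. matched k v u)" for v
  proof
    assume "\<exists>e\<in>M. (k, v) = fst e"
    then obtain e where "e \<in> M" "(k, v) = fst e" by blast
    then show "\<exists>u. matched k v u" by (cases rule: M_cases) auto
  next
    assume "\<exists>u. matched k v u"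
    then obtain u where "((k, v), (k - 1, u)) \<in> M" by (auto simp: matched_def)
    then show "\<exists>e\<in>M. (k, v) = fst e" by (rule bexI[rotated]) simp
  qed
  have tgt: "(\<exists>e\<in>M. (k, v) = snd e) \<longleftrightarrow> (\<exists>u. matched (k + 1) u v)" for v
  proof
    assume "\<exists>e\<in>M. (k, v) = snd e"
    then obtain e where "e \<in> M" "(k, v) = snd e" by blast
    then show "\<exists>u. matched (k + 1) u v" by (cases rule: M_cases) auto
  next
    assume "\<exists>u. matched (k + 1) u v"
    then obtain u where "((k + 1, u), (k, v)) \<in> M" by (auto simp: matched_def)
    then show "\<exists>e\<in>M. (k, v) = snd e" by (rule bexI[rotated]) simp
  qed
  have "v \<in> critical I M k \<longleftrightarrow> v \<in> I k \<and> \<not> (\<exists>e\<in>M. (k, v) = fst e) \<and> \<not> (\<exists>e\<in>M. (k, v) = snd e)" for v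
    unfolding critical_def by blast
  then show ?thesis unfolding src tgt sources_def targets_def by blast
qed

lemma sources_not_targets: "v \<in> sources k \<Longrightarrow> v \<notin> targets k"
  using matched_unique(3) by (auto simp: sources_def targets_def)

lemma subsets_I: "critical I M k \<subseteq> I k" "sources k \<subseteq> I k" "targets k \<subseteq> I k"
  by (auto simp: critical_iff sources_def targets_def)

lemma arcs_iff:
  "((k, v), (l, u)) \<in> parcs (morse_graph C I M) \<longleftrightarrow>
    l = k - 1 \<and> v \<in> I k \<and> u \<in> I l \<and> D k u v \<noteq> 0 \<and> \<not> matched k v u \<or> l = k + 1 \<and> matched l u v"
proof -
  have "((l, u), (k, v)) \<in> M \<longleftrightarrow> l = k + 1 \<and> matched l u v"
  proof
    assume "((l, u), (k, v)) \<in> M"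
    then show "l = k + 1 \<and> matched l u v" by (cases rule: M_cases) simp
  qed (auto simp: matched_def)
  then show ?thesis
    by (auto simp: morse_graph_def complex_graph_def matched_def)
qed

lemma arcs_cases:
  assumes "e \<in> arcs G"
  obtains (down) k v u where "e = ((k, v), (k - 1, u))" "v \<in> I k" "u \<in> I (k - 1)" "D k u v \<noteq> 0" "\<not> matched k v u"
  | (up) k v u where "e = ((k - 1, u), (k, v))" "matched k v u"
proof -
  obtain k v l u where e: "e = ((k, v), (l, u))" by (metis surj_pair)
  then have "((k, v), (l, u)) \<in> parcs (morse_graph C I M)" using assms by simp
  then show thesis unfolding arcs_iff using that(1)[of k v u] that(2)[of l v u] e by auto
qed

lemma verts_G: "pverts (morse_graph C I M) = (SIGMA k:UNIV. I k)"
  by (simp add: morse_graph_def complex_graph_def)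

lemma fin_digraph_G: "fin_digraph G"
proof
  show e: "tail G e \<in> verts G" "head G e \<in> verts G" if "e \<in> arcs G" for e
    using that by (cases rule: arcs_cases; auto simp: verts_G dest: matchedD)+
  show fin: "finite (verts G)"
    by (simp add: verts_G finite_vertices)
  have "arcs G \<subseteq> verts G \<times> verts G"
  proof
    fix x assume "x \<in> arcs G"
    then show "x \<in> verts G \<times> verts G" using e[of x] by (simp add: mem_Times_iff)
  qed
  then show "finite (arcs G)" by (rule finite_subset) (intro finite_cartesian_product fin)
qed

sublocale P: acyclic_weighted_digraph G w
  by (intro acyclic_weighted_digraph.intro fin_digraph_G acyclic_weighted_digraph_axioms.intro)
    (use matching in \<open>auto simp: morse_matching_def\<close>)

abbreviation "P \<equiv> P.path_total"

lemma weights: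
  shows "w ((k, v), (k - 1, u)) = D k u v"
    and "matched k v u \<Longrightarrow> w ((k - 1, u), (k, v)) = - 1 / D k u v"
proof -
  have "((k - 1, u), (k, v)) \<notin> M"
  proof
    assume "((k - 1, u), (k, v)) \<in> M"
    then show False by (rule M_cases) auto
  qed
  then show "w ((k, v), (k - 1, u)) = D k u v"
    by (simp add: morse_weight_def edge_weight_def)
  show "matched k v u \<Longrightarrow> w ((k - 1, u), (k, v)) = - 1 / D k u v"
    by (simp add: morse_weight_def edge_weight_def matched_def)
qed

text \<open>The entries of the weight matrix \<open>N\<close> between two adjacent degrees, extended by zero to pairs that are
  not arcs.  Sums over arcs thereby become sums over whole bases, which can be compared with
  matrix products.\<close>

definition down :: "int \<Rightarrow> 'v \<Rightarrow> 'v \<Rightarrow> 'k" where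
  "down k v u = (if matched k v u then 0 else D k u v)"

definition up :: "int \<Rightarrow> 'v \<Rightarrow> 'v \<Rightarrow> 'k" where
  "up k u v = (if matched k v u then - 1 / D k u v else 0)"

lemma P_first_step:
  assumes v: "v \<in> I k"
  shows "P (k, v) b = (if (k, v) = b then 1 else 0) +
    (\<Sum>u\<in>I (k - 1). down k v u * P (k - 1, u) b) + (\<Sum>x\<in>I (k + 1). up (k + 1) v x * P (k + 1, x) b)"
proof -
  let ?A = "{u \<in> I (k - 1). D k u v \<noteq> 0 \<and> \<not> matched k v u}" and ?B = "{x \<in> I (k + 1). matched (k + 1) x v}"
  let ?f = "\<lambda>u. ((k, v), (k - 1, u))" and ?g = "\<lambda>x. ((k, v), (k + 1, x))"
  let ?s = "\<lambda>e. w e * P (head G e) b"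
  have E: "{e \<in> arcs G. tail G e = (k, v)} = ?f ` ?A \<union> ?g ` ?B"
  proof (intro equalityI subsetI)
    fix e assume e: "e \<in> {e \<in> arcs G. tail G e = (k, v)}"
    obtain l u where lu: "e = ((k, v), (l, u))" using e by (cases e) auto
    then have "((k, v), (l, u)) \<in> parcs (morse_graph C I M)" using e by simp
    then show "e \<in> ?f ` ?A \<union> ?g ` ?B" unfolding arcs_iff lu by (auto dest: matchedD)
  qed (use v in \<open>auto simp: arcs_iff\<close>)
  have vG: "(k, v) \<in> verts G" using v by (simp add: verts_G)
  have "(\<Sum>e | e \<in> arcs G \<and> tail G e = (k, v). ?s e) = sum ?s (?f ` ?A) + sum ?s (?g ` ?B)"
    unfolding E by (rule sum.union_disjoint) (use finite_I in auto)
  also have "sum ?s (?f ` ?A) = (\<Sum>u\<in>?A. down k v u * P (k - 1, u) b)"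
    by (subst sum.reindex) (auto simp: inj_on_def weights down_def)
  also have "\<dots> = (\<Sum>u\<in>I (k - 1). down k v u * P (k - 1, u) b)"
    by (rule sum.mono_neutral_left) (use finite_I in \<open>auto simp: down_def\<close>)
  also have "sum ?s (?g ` ?B) = (\<Sum>x\<in>?B. up (k + 1) v x * P (k + 1, x) b)"
    using weights(2)[of "k + 1"] by (subst sum.reindex) (auto simp: inj_on_def up_def)
  also have "\<dots> = (\<Sum>x\<in>I (k + 1). up (k + 1) v x * P (k + 1, x) b)"
    by (rule sum.mono_neutral_left) (use finite_I in \<open>auto simp: up_def\<close>)
  finally show ?thesis
    by (simp only: P.path_total_first_step[OF vG] add.assoc)
qed

lemma P_last_step:
  assumes a: "a \<in> verts G" and v: "v \<in> I k"
  shows "P a (k, v) = (if a = (k, v) then 1 else 0) +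
    (\<Sum>x\<in>I (k + 1). P a (k + 1, x) * down (k + 1) x v) + (\<Sum>u\<in>I (k - 1). P a (k - 1, u) * up k u v)"
proof -
  let ?A = "{x \<in> I (k + 1). D (k + 1) v x \<noteq> 0 \<and> \<not> matched (k + 1) x v}" and ?B = "{u \<in> I (k - 1). matched k v u}"
  let ?f = "\<lambda>x. ((k + 1, x), (k, v))" and ?g = "\<lambda>u. ((k - 1, u), (k, v))"
  let ?s = "\<lambda>e. P a (tail G e) * w e"
  have E: "{e \<in> arcs G. head G e = (k, v)} = ?f ` ?A \<union> ?g ` ?B"
  proof (intro equalityI subsetI)
    fix e assume e: "e \<in> {e \<in> arcs G. head G e = (k, v)}"
    obtain l u where lu: "e = ((l, u), (k, v))" using e by (cases e) auto
    then have "((l, u), (k, v)) \<in> parcs (morse_graph C I M)" using e by simp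
    then show "e \<in> ?f ` ?A \<union> ?g ` ?B" unfolding arcs_iff lu by (auto dest: matchedD)
  qed (use v in \<open>auto simp: arcs_iff\<close>)
  have "(\<Sum>e | e \<in> arcs G \<and> head G e = (k, v). ?s e) = sum ?s (?f ` ?A) + sum ?s (?g ` ?B)"
    unfolding E by (rule sum.union_disjoint) (use finite_I in auto)
  also have "sum ?s (?f ` ?A) = (\<Sum>x\<in>?A. P a (k + 1, x) * down (k + 1) x v)"
    using weights(1)[of "k + 1"] by (subst sum.reindex) (auto simp: inj_on_def down_def)
  also have "\<dots> = (\<Sum>x\<in>I (k + 1). P a (k + 1, x) * down (k + 1) x v)"
    by (rule sum.mono_neutral_left) (use finite_I in \<open>auto simp: down_def\<close>)
  also have "sum ?s (?g ` ?B) = (\<Sum>u\<in>?B. P a (k - 1, u) * up k u v)"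
    by (subst sum.reindex) (auto simp: inj_on_def weights up_def)
  also have "\<dots> = (\<Sum>u\<in>I (k - 1). P a (k - 1, u) * up k u v)"
    by (rule sum.mono_neutral_left) (use finite_I in \<open>auto simp: up_def\<close>)
  finally show ?thesis
    by (simp only: P.path_total_last_step[OF a, of "(k, v)"] add.assoc)
qed

text \<open>Two potentials on the matched graph.  Arcs lose one degree, except the reversed matched ones, which
  gain one degree from a target to a source.  Counting targets one degree higher, or sources one
  degree lower, levels these arcs out, and the other arcs still never rise.\<close>

definition level_source :: "'v vertex \<Rightarrow> int" where
  "level_source a = (if snd a \<in> targets (fst a) then fst a + 1 else fst a)"

definition level_target :: "'v vertex \<Rightarrow> int" where
  "level_target a = (if snd a \<in> sources (fst a) then fst a - 1 else fst a)"

lemma level_source_antimono: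
  assumes "P a b \<noteq> 0" shows "level_source b \<le> level_source a"
proof (rule P.path_total_potential[OF _ assms])
  fix e assume "e \<in> arcs G"
  then show "level_source (head G e) \<le> level_source (tail G e)"
  proof (cases rule: arcs_cases)
    case (down k v u)
    then show ?thesis by (simp add: level_source_def)
  next
    case (up k v u)
    then have "u \<in> targets (k - 1)" "v \<in> sources k"
      using matchedD[OF up(2)] by (auto simp: sources_def targets_def)
    then have "v \<notin> targets k" "u \<in> targets (k - 1)" using sources_not_targets by blast+
    then show ?thesis using up by (simp add: level_source_def)
  qed
qed

lemma level_target_antimono:
  assumes "P a b \<noteq> 0" shows "level_target b \<le> level_target a"
proof (rule P.path_total_potential[OF _ assms])
  fix e assume "e \<in> arcs G"
  then show "level_target (head G e) \<le> level_target (tail G e)"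
  proof (cases rule: arcs_cases)
    case (down k v u)
    then show ?thesis by (simp add: level_target_def)
  next
    case (up k v u)
    then have "u \<in> targets (k - 1)" "v \<in> sources k"
      using matchedD[OF up(2)] by (auto simp: sources_def targets_def)
    then have "u \<notin> sources (k - 1)" "v \<in> sources k" using sources_not_targets by blast+
    then show ?thesis using up by (simp add: level_target_def)
  qed
qed

lemma P_two_up:
  assumes "l \<ge> k + 2" shows "P (k, x) (l, y) = 0"
proof (rule ccontr)
  assume "P (k, x) (l, y) \<noteq> 0"
  from level_source_antimono[OF this] show False
    using assms by (simp add: level_source_def split: if_splits)
qed

text \<open>The first potential shows that the path starts in a target, the second that it ends in a
  source.\<close>

lemma P_one_up:
  assumes "P (k, x) (k + 1, y) \<noteq> 0"
  shows "x \<in> targets k" "y \<in> sources (k + 1)"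
  using level_source_antimono[OF assms] level_target_antimono[OF assms]
  by (simp_all add: level_source_def level_target_def split: if_splits)

lemma not_targets_first_step:
  assumes v: "v \<in> I k" "v \<notin> targets k"
  shows "P (k, v) b = (if (k, v) = b then 1 else 0) + (\<Sum>u\<in>I (k - 1). down k v u * P (k - 1, u) b)"
proof -
  have "up (k + 1) v x = 0" for x using v by (auto simp: up_def targets_def)
  then show ?thesis using P_first_step[OF v(1), of b] by simp
qed

lemma not_sources_last_step:
  assumes a: "a \<in> verts G" and v: "v \<in> I k" "v \<notin> sources k"
  shows "P a (k, v) = (if a = (k, v) then 1 else 0) + (\<Sum>x\<in>I (k + 1). P a (k + 1, x) * down (k + 1) x v)"
proof -
  have "up k u v = 0" for u using v by (auto simp: up_def sources_def)
  then show ?thesis using P_last_step[OF a v(1)] by simp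
qed

lemma critical_first_step:
  assumes "v \<in> critical I M k"
  shows "P (k, v) b = (if (k, v) = b then 1 else 0) + (\<Sum>u\<in>I (k - 1). D k u v * P (k - 1, u) b)"
proof -
  have "down k v u = D k u v" for u using assms by (auto simp: down_def critical_iff sources_def)
  then show ?thesis using not_targets_first_step[of v k b] assms by (simp add: critical_iff)
qed

lemma critical_last_step:
  assumes "a \<in> verts G" "u \<in> critical I M k"
  shows "P a (k, u) = (if a = (k, u) then 1 else 0) + (\<Sum>x\<in>I (k + 1). P a (k + 1, x) * D (k + 1) u x)"
proof -
  have "down (k + 1) x u = D (k + 1) u x" for x
    using assms by (auto simp: down_def critical_iff targets_def)
  then show ?thesis using not_sources_last_step[of a u k] assms by (simp add: critical_iff)
qed

text \<open>In terms of maps: \<open>h (d x) = - x\<close> for a source \<open>x\<close>.  Let \<open>u\<close> be the partner of \<open>x\<close>.  A path from \<open>u\<close>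
  up to \<open>y\<close> must begin with the reversed edge to \<open>x\<close>, since after a step down it would have to gain two
  degrees.  So the matched term of the sum is \<open>- P (k, x) (k, y)\<close>.  The other terms sum over the
  paths from \<open>x\<close> to \<open>y\<close> with at least one step, because a source has no step up.\<close>

lemma source_row:
  assumes x: "x \<in> sources k" and y: "y \<in> I k"
  shows "(\<Sum>c\<in>I (k - 1). D k c x * P (k - 1, c) (k, y)) = - (if x = y then 1 else 0)"
proof -
  obtain u where m: "matched k x u" using x by (auto simp: sources_def)
  note mD = matchedD[OF m]
  have "(\<Sum>c\<in>I (k - 1 - 1). down (k - 1) u c * P (k - 1 - 1, c) (k, y)) = 0"
    by (rule sum.neutral) (simp add: P_two_up)
  then have "P (k - 1, u) (k, y) = (\<Sum>z\<in>I k. up k u z * P (k, z) (k, y))"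
    using P_first_step[OF mD(2), of "(k, y)"] by simp
  also have "\<dots> = (\<Sum>z\<in>I k. if z = x then up k u x * P (k, x) (k, y) else 0)"
    by (rule sum.cong) (auto simp: up_def dest: matched_unique(2)[OF m])
  also have "\<dots> = - P (k, x) (k, y) / D k u x"
    using mD finite_I m by (simp add: up_def)
  finally have "D k u x * P (k - 1, u) (k, y) = - P (k, x) (k, y)" using mD(3) by simp
  moreover have "P (k, x) (k, y) = (if x = y then 1 else 0) +
      (\<Sum>c\<in>I (k - 1). down k x c * P (k - 1, c) (k, y))"
    using not_targets_first_step[of x k "(k, y)"] mD sources_not_targets[OF x] by simp
  moreover have "(\<Sum>c\<in>I (k - 1). D k c x * P (k - 1, c) (k, y)) =
      (\<Sum>c\<in>I (k - 1). down k x c * P (k - 1, c) (k, y)) + D k u x * P (k - 1, u) (k, y)"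
  proof -
    have "(\<Sum>c\<in>I (k - 1). D k c x * P (k - 1, c) (k, y)) =
        (\<Sum>c\<in>I (k - 1). down k x c * P (k - 1, c) (k, y)
          + (if c = u then D k u x * P (k - 1, u) (k, y) else 0))"
      by (rule sum.cong) (use m in \<open>auto simp: down_def dest: matched_unique(1)[OF m]\<close>)
    also have "\<dots> = (\<Sum>c\<in>I (k - 1). down k x c * P (k - 1, c) (k, y)) + D k u x * P (k - 1, u) (k, y)"
      using finite_I mD(2) by (simp add: sum.distrib)
    finally show ?thesis .
  qed
  ultimately show ?thesis by simp
qed

text \<open>The mirror image of \<open>source_row\<close>, with last steps in place of first steps: \<open>d (h x)\<close> cancels the
  coordinate of \<open>x\<close> at every target \<open>y\<close>.\<close>

lemma target_column:
  assumes x: "x \<in> I k" and y: "y \<in> targets k"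
  shows "(\<Sum>c\<in>I (k + 1). P (k, x) (k + 1, c) * D (k + 1) y c) = - (if x = y then 1 else 0)"
proof -
  obtain v where m: "matched (k + 1) v y" using y by (auto simp: targets_def)
  have yI: "y \<in> I k" and yS: "y \<notin> sources k" using y subsets_I sources_not_targets by blast+
  note mD = matchedD[OF m]
  have xG: "(k, x) \<in> verts G" using x by (simp add: verts_G)
  have "(\<Sum>c\<in>I (k + 1 + 1). P (k, x) (k + 1 + 1, c) * down (k + 1 + 1) c v) = 0"
    by (rule sum.neutral) (simp add: P_two_up)
  then have "P (k, x) (k + 1, v) = (\<Sum>z\<in>I k. P (k, x) (k, z) * up (k + 1) z v)"
    using P_last_step[OF xG mD(1)] by simp
  also have "\<dots> = (\<Sum>z\<in>I k. if z = y then P (k, x) (k, y) * up (k + 1) y v else 0)"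
    by (rule sum.cong) (auto simp: up_def dest: matched_unique(1)[OF m])
  also have "\<dots> = - P (k, x) (k, y) / D (k + 1) y v"
    using mD finite_I m by (simp add: up_def)
  finally have "P (k, x) (k + 1, v) * D (k + 1) y v = - P (k, x) (k, y)" using mD(3) by simp
  moreover have "P (k, x) (k, y) = (if x = y then 1 else 0) +
      (\<Sum>c\<in>I (k + 1). P (k, x) (k + 1, c) * down (k + 1) c y)"
    using not_sources_last_step[OF xG yI yS] by simp
  moreover have "(\<Sum>c\<in>I (k + 1). P (k, x) (k + 1, c) * D (k + 1) y c) =
      (\<Sum>c\<in>I (k + 1). P (k, x) (k + 1, c) * down (k + 1) c y) + P (k, x) (k + 1, v) * D (k + 1) y v"
  proof -
    have "(\<Sum>c\<in>I (k + 1). P (k, x) (k + 1, c) * D (k + 1) y c) =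
        (\<Sum>c\<in>I (k + 1). P (k, x) (k + 1, c) * down (k + 1) c y
          + (if c = v then P (k, x) (k + 1, v) * D (k + 1) y v else 0))"
      by (rule sum.cong) (use m in \<open>auto simp: down_def dest: matched_unique(2)[OF m]\<close>)
    also have "\<dots> = (\<Sum>c\<in>I (k + 1). P (k, x) (k + 1, c) * down (k + 1) c y) + P (k, x) (k + 1, v) * D (k + 1) y v"
      using finite_I mD(1) by (simp add: sum.distrib)
    finally show ?thesis .
  qed
  ultimately show ?thesis by simp
qed

section \<open>The contraction given by a matching\<close>

lemma finite_paths: "finite (morse_paths C I M a b)"
  unfolding morse_paths_def by (rule P.apaths_finite)

lemma path_sum_coord:
  assumes J: "J \<subseteq> I l"
  shows "path_sum C I M a l J \<in> carrier (V l)"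
    and "cc l (path_sum C I M a l J) y = (if y \<in> J then P a (l, y) else 0)"
proof -
  let ?S = "SIGMA u:J. morse_paths C I M a (l, u)"
  let ?f = "\<lambda>(u, \<gamma>). path_weight C I M \<gamma> \<odot>\<^bsub>V l\<^esub> u"
  have finJ: "finite J" using J finite_I finite_subset by blast
  then have S: "finite ?S" using finite_paths by auto
  have in_I: "u \<in> I l" if "u \<in> J" for u using J that by blast
  have f: "?f \<in> ?S \<rightarrow> V.span l (I l)"
    using in_I F.span_smult F.B_sub_span by auto
  note cf = F.coord_finsum[OF S f, of y]
  show "path_sum C I M a l J \<in> carrier (V l)"
    unfolding path_sum_def using cf by (simp add: span_I)
  have "cc l (path_sum C I M a l J) y = (\<Sum>(u, \<gamma>)\<in>?S. path_weight C I M \<gamma> * (if y = u then 1 else 0))"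
    unfolding path_sum_def using cf
    by (auto simp: F.coord_smult F.B_sub_span F.coord_basis in_I intro!: sum.cong)
  also have "\<dots> = (\<Sum>u\<in>J. \<Sum>\<gamma>\<in>morse_paths C I M a (l, u). path_weight C I M \<gamma> * (if y = u then 1 else 0))"
    by (rule sum.Sigma[symmetric]) (use finJ finite_paths in auto)
  also have "\<dots> = (\<Sum>u\<in>J. if y = u then P a (l, y) else 0)"
    by (rule sum.cong) (auto simp: P.path_total_def morse_paths_def path_weight_def)
  also have "\<dots> = (if y \<in> J then P a (l, y) else 0)" using finJ by simp
  finally show "cc l (path_sum C I M a l J) y = (if y \<in> J then P a (l, y) else 0)" .
qed

text \<open>The contraction \<open>h\<close>: all paths from degree \<open>k\<close> to degree \<open>k + 1\<close>.\<close>

definition htpy :: "int \<Rightarrow> 'v \<Rightarrow> 'v" where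
  "htpy k = lin_ext (V k) (I k) (V (k + 1)) (\<lambda>v. path_sum C I M (k, v) (k + 1) (I (k + 1)))"

lemma htpy_lin: "linear_map class_ring (V k) (V (k + 1)) (htpy k)"
  unfolding htpy_def by (rule lin_ext_maps) (rule path_sum_coord(1)[OF subset_refl])

lemmas h_maps = linear_mapD(3-6)[OF htpy_lin]

lemma htpy_lin': "linear_map class_ring (V (k - 1)) (V k) (htpy (k - 1))"
  using htpy_lin[of "k - 1"] by simp

lemmas hm_maps = linear_mapD(3-6)[OF htpy_lin']

lemma coord_htpy:
  assumes "x \<in> carrier (V k)" "y \<in> I (k + 1)"
  shows "cc (k + 1) (htpy k x) y = (\<Sum>v\<in>I k. cc k x v * P (k, v) (k + 1, y))"
proof -
  have "htpy k v = path_sum C I M (k, v) (k + 1) (I (k + 1))" if "v \<in> I k" for v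
    unfolding htpy_def by (rule lin_ext_maps(2)[OF _ that]) (rule path_sum_coord(1)[OF subset_refl])
  then show ?thesis
    using coord_linear_I[OF htpy_lin assms(1), of y] assms(2)
    by (simp add: path_sum_coord(2)[OF subset_refl])
qed

lemma coord_bdry_htpy:
  assumes x: "x \<in> carrier (V k)"
  shows "cc k (d (k + 1) (htpy k x)) y =
    (\<Sum>v\<in>I k. cc k x v * (\<Sum>c\<in>I (k + 1). P (k, v) (k + 1, c) * D (k + 1) y c))"
proof -
  have "cc k (d (k + 1) (htpy k x)) y =
      (\<Sum>c\<in>I (k + 1). (\<Sum>v\<in>I k. cc k x v * P (k, v) (k + 1, c)) * D (k + 1) y c)"
    using coord_bdry[of "htpy k x" "k + 1" y] h_maps(1)[OF x] x by (simp add: coord_htpy)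
  also have "\<dots> = (\<Sum>v\<in>I k. \<Sum>c\<in>I (k + 1). cc k x v * P (k, v) (k + 1, c) * D (k + 1) y c)"
    by (simp add: sum_distrib_right sum.swap[of _ _ "I k"])
  finally show ?thesis by (simp add: sum_distrib_left mult.assoc)
qed

lemma coord_htpy_bdry:
  assumes x: "x \<in> carrier (V k)" and y: "y \<in> I k"
  shows "cc k (htpy (k - 1) (d k x)) y =
    (\<Sum>v\<in>I k. cc k x v * (\<Sum>c\<in>I (k - 1). D k c v * P (k - 1, c) (k, y)))"
proof -
  have "cc k (htpy (k - 1) (d k x)) y =
      (\<Sum>c\<in>I (k - 1). (\<Sum>v\<in>I k. cc k x v * D k c v) * P (k - 1, c) (k, y))"
    using coord_htpy[of "d k x" "k - 1" y] d_maps(1)[OF x] x y by (simp add: coord_bdry)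
  also have "\<dots> = (\<Sum>v\<in>I k. \<Sum>c\<in>I (k - 1). cc k x v * D k c v * P (k - 1, c) (k, y))"
    by (simp add: sum_distrib_right sum.swap[of _ _ "I k"])
  finally show ?thesis by (simp add: sum_distrib_left mult.assoc)
qed

lemma htpy_zero:
  assumes x: "x \<in> carrier (V k)" and z: "\<And>v. v \<in> targets k \<Longrightarrow> cc k x v = 0"
  shows "htpy k x = \<zero>\<^bsub>V (k + 1)\<^esub>"
proof (rule eq_coordsI)
  fix y assume y: "y \<in> I (k + 1)"
  have "cc k x v * P (k, v) (k + 1, y) = 0" for v
    using z[of v] P_one_up(1)[of k v y] by auto
  then show "cc (k + 1) (htpy k x) y = cc (k + 1) \<zero>\<^bsub>V (k + 1)\<^esub> y"
    using coord_htpy[OF x y] by (simp add: F.coord_zero)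
qed (use h_maps(1)[OF x] in auto)

lemma targets_span:
  "x \<in> V.span k (critical I M k) \<Longrightarrow> v \<in> targets k \<Longrightarrow> cc k x v = 0"
  "x \<in> V.span k (sources k) \<Longrightarrow> v \<in> targets k \<Longrightarrow> cc k x v = 0"
  using subsets_I[of k] sources_not_targets[of v k]
  by (auto simp: span_sub_iff critical_iff)

sublocale contraction: matching_contraction C
  "\<lambda>k. V.span k (critical I M k)" "\<lambda>k. V.span k (sources k)" htpy "\<lambda>k. part k (critical I M k)"
proof (rule matching_contraction.intro)
  note sub = F.B_sub subsets_I
  have crit_carrier: "critical I M k \<subseteq> carrier (V k)" "sources k \<subseteq> carrier (V k)" for k
    using sub by blast+
  fix k x
  show "fd_chain_complex C" by (rule fd)
  show S: "submodule class_ring (V.span k (critical I M k)) (V k)"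
    by (rule V.span_is_submodule[OF crit_carrier(1)])
  show T: "V.span k (sources k) \<subseteq> carrier (V k)"
    by (rule V.span_is_subset2[OF crit_carrier(2)])
  show "vectorspace.fin_dim class_ring ((V k)\<lparr>carrier := V.span k (critical I M k)\<rparr>)"
  proof -
    interpret S: vectorspace class_ring "(V k)\<lparr>carrier := V.span k (critical I M k)\<rparr>"
      by (intro V.subspace_is_vs subspace.intro V.vectorspace_axioms S)
    have "critical I M k \<subseteq> V.span k (critical I M k)" by (rule V.in_own_span[OF crit_carrier(1)])
    then show ?thesis
      unfolding S.fin_dim_def using V.span_li_not_depend(1)[OF _ S] finite_subset[OF subsets_I(1) finite_I]
      by (intro exI[of _ "critical I M k"]) simp
  qed
  show "linear_map class_ring (V k) (V (k + 1)) (htpy k)" by (rule htpy_lin)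
  show "linear_map class_ring (V k) (V k) (part k (critical I M k))" by (rule part_lin)
  show "htpy k x = \<zero>\<^bsub>V (k + 1)\<^esub>" if "x \<in> V.span k (critical I M k)"
    using htpy_zero targets_span(1) that span_sub_iff[OF subsets_I(1)] by blast
  show "htpy k x = \<zero>\<^bsub>V (k + 1)\<^esub>" if "x \<in> V.span k (sources k)"
    using htpy_zero targets_span(2) that span_sub_iff[OF subsets_I(2)] by blast
  show "part k (critical I M k) x = x" if x: "x \<in> V.span k (critical I M k)"
    by (rule eq_coordsI) (use x p_maps(1) span_sub_iff[OF subsets_I(1)] in \<open>auto simp: coord_part subsets_I(1)\<close>)
  show "part k (critical I M k) x = \<zero>\<^bsub>V k\<^esub>" if x: "x \<in> V.span k (sources k)"
  proof (rule eq_coordsI)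
    have xc: "x \<in> carrier (V k)" using x T by blast
    show "part k (critical I M k) x \<in> carrier (V k)" "\<zero>\<^bsub>V k\<^esub> \<in> carrier (V k)"
      using p_maps(1)[OF xc] by auto
    fix v assume "v \<in> I k"
    have "v \<in> critical I M k \<Longrightarrow> v \<in> I k - sources k" by (simp add: critical_iff)
    then show "cc k (part k (critical I M k) x) v = cc k \<zero>\<^bsub>V k\<^esub> v"
      using x span_sub_iff[OF subsets_I(2)] coord_part[OF xc subsets_I(1), of v]
      by (simp add: F.coord_zero)
  qed
  show "x \<oplus>\<^bsub>V k\<^esub> htpy (k - 1) (d k x) = \<zero>\<^bsub>V k\<^esub>" if x: "x \<in> V.span k (sources k)"
  proof (rule eq_coordsI)
    have xc: "x \<in> carrier (V k)" using x T by blast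
    have hc: "htpy (k - 1) (d k x) \<in> carrier (V k)" using xc d_maps(1) hm_maps(1) by blast
    show "x \<oplus>\<^bsub>V k\<^esub> htpy (k - 1) (d k x) \<in> carrier (V k)" "\<zero>\<^bsub>V k\<^esub> \<in> carrier (V k)"
      using xc hc by auto
    fix y assume y: "y \<in> I k"
    have "cc k x v * (\<Sum>c\<in>I (k - 1). D k c v * P (k - 1, c) (k, y)) = (if v = y then - cc k x y else 0)"
      if v: "v \<in> I k" for v
    proof (cases "v \<in> sources k")
      case True
      then show ?thesis using source_row[OF True y] by simp
    next
      case False
      then show ?thesis using x v span_sub_iff[OF subsets_I(2)] by auto
    qed
    then have "cc k (htpy (k - 1) (d k x)) y = (\<Sum>v\<in>I k. if v = y then - cc k x y else 0)"
      using coord_htpy_bdry[OF xc y] by (simp cong: sum.cong)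
    then show "cc k (x \<oplus>\<^bsub>V k\<^esub> htpy (k - 1) (d k x)) y = cc k \<zero>\<^bsub>V k\<^esub> y"
      using cc_add[OF xc hc] y finite_I by (simp add: F.coord_zero)
  qed
  assume x: "x \<in> carrier (V k)"
  show "htpy k x \<in> V.span (k + 1) (sources (k + 1))"
    unfolding span_sub_iff[OF subsets_I(2)]
  proof (intro conjI ballI)
    show "htpy k x \<in> carrier (V (k + 1))" by (rule h_maps(1)[OF x])
    fix y assume y: "y \<in> I (k + 1) - sources (k + 1)"
    then have "P (k, v) (k + 1, y) = 0" for v using P_one_up(2)[of k v y] by auto
    then show "cc (k + 1) (htpy k x) y = 0" using coord_htpy[OF x] y by simp
  qed
  show "part k (critical I M k) x \<in> V.span k (critical I M k)"
    unfolding span_sub_iff[OF subsets_I(1)] using p_maps(1)[OF x] coord_part[OF x subsets_I(1)] by auto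
  let ?y = "x \<oplus>\<^bsub>V k\<^esub> d (k + 1) (htpy k x)"
  have dh: "d (k + 1) (htpy k x) \<in> carrier (V k)" using x h_maps(1) d1_maps(1) by blast
  then have yc: "?y \<in> carrier (V k)" using x by auto
  have y0: "cc k ?y u = 0" if u: "u \<in> targets k" for u
  proof -
    have "cc k (d (k + 1) (htpy k x)) u = (\<Sum>v\<in>I k. if v = u then - cc k x u else 0)"
      unfolding coord_bdry_htpy[OF x] by (rule sum.cong) (use target_column[OF _ u] in auto)
    then show ?thesis using cc_add[OF x dh] u subsets_I(3)[of k] finite_I by auto
  qed
  show "\<exists>a\<in>V.span k (sources k). ?y = part k (critical I M k) ?y \<oplus>\<^bsub>V k\<^esub> a"
  proof -
    let ?a = "part k (sources k) ?y"
    have ac: "?a \<in> carrier (V k)" by (rule p_maps(1)[OF yc])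
    have ca: "cc k ?a y = (if y \<in> sources k then cc k ?y y else 0)" for y
      by (rule coord_part[OF yc subsets_I(2)])
    have pc: "part k (critical I M k) ?y \<in> carrier (V k)" by (rule p_maps(1)[OF yc])
    have "?y = part k (critical I M k) ?y \<oplus>\<^bsub>V k\<^esub> ?a"
    proof (rule eq_coordsI[OF yc])
      show "part k (critical I M k) ?y \<oplus>\<^bsub>V k\<^esub> ?a \<in> carrier (V k)" using pc ac by auto
      fix v assume "v \<in> I k"
      then show "cc k ?y v = cc k (part k (critical I M k) ?y \<oplus>\<^bsub>V k\<^esub> ?a) v"
        unfolding cc_add[OF pc ac] ca coord_part[OF yc subsets_I(1)]
        using y0[of v] by (auto simp: critical_iff)
    qed
    moreover have "?a \<in> V.span k (sources k)"
      unfolding span_sub_iff[OF subsets_I(2)] using ac ca by auto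
    ultimately show ?thesis by blast
  qed
qed

section \<open>Reductions are retractions\<close>

text \<open>A path to a critical vertex ends with a step down along an unmatched edge or is trivial, so by the
  last-step recursion it is counted by \<open>1 + d h\<close>.\<close>

lemma coord_proj:
  assumes b: "b \<in> I k"
  shows "cc k (contraction.proj k b) u = (if u \<in> critical I M k then P (k, b) (k, u) else 0)"
proof -
  have bc: "b \<in> carrier (V k)" by (rule I_carrier[OF b])
  have dh: "d (k + 1) (htpy k b) \<in> carrier (V k)" using bc h_maps(1) d1_maps(1) by blast
  have bG: "(k, b) \<in> verts G" using b by (simp add: verts_G)
  have "cc k (d (k + 1) (htpy k b)) u =
      (\<Sum>v\<in>I k. if v = b then (\<Sum>c\<in>I (k + 1). P (k, b) (k + 1, c) * D (k + 1) u c) else 0)"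
    unfolding coord_bdry_htpy[OF bc] by (rule sum.cong) (auto simp: F.coord_basis[OF b])
  then have "cc k (d (k + 1) (htpy k b)) u = (\<Sum>c\<in>I (k + 1). P (k, b) (k + 1, c) * D (k + 1) u c)"
    using b finite_I by simp
  moreover have "b \<oplus>\<^bsub>V k\<^esub> d (k + 1) (htpy k b) \<in> carrier (V k)" using bc dh by auto
  ultimately show ?thesis
    unfolding contraction.proj_def
    using critical_last_step[OF bG, of u k]
    by (auto simp: coord_part subsets_I cc_add[OF bc dh] F.coord_basis[OF b])
qed

lemma path_sum_critical:
  assumes b: "b \<in> I k"
  shows "path_sum C I M (k, b) k (critical I M k) = contraction.proj k b"
proof (rule eq_coordsI)
  show "path_sum C I M (k, b) k (critical I M k) \<in> carrier (V k)"
    by (rule path_sum_coord(1)[OF subsets_I(1)])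
  show "contraction.proj k b \<in> carrier (V k)"
    by (rule contraction.proj_maps(1)[OF I_carrier[OF b]])
qed (simp add: path_sum_coord(2)[OF subsets_I(1)] coord_proj[OF b])

text \<open>Dually, a path from a critical vertex is trivial or begins with a step down, and is counted by
  \<open>1 + h d\<close>.\<close>

lemma path_sum_incl:
  assumes v: "v \<in> critical I M k"
  shows "path_sum C I M (k, v) k (I k) = contraction.incl k v"
proof (rule eq_coordsI)
  have vI: "v \<in> I k" using v subsets_I(1) by blast
  note vc = I_carrier[OF vI]
  have hd: "htpy (k - 1) (d k v) \<in> carrier (V k)" using vc d_maps(1) hm_maps(1) by blast
  show "path_sum C I M (k, v) k (I k) \<in> carrier (V k)" by (rule path_sum_coord(1)[OF subset_refl])
  show "contraction.incl k v \<in> carrier (V k)" by (rule contraction.incl_maps(1)[OF vc])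
  fix y assume y: "y \<in> I k"
  have "cc k (htpy (k - 1) (d k v)) y =
      (\<Sum>x\<in>I k. if x = v then (\<Sum>c\<in>I (k - 1). D k c v * P (k - 1, c) (k, y)) else 0)"
    unfolding coord_htpy_bdry[OF vc y] by (rule sum.cong) (auto simp: F.coord_basis[OF vI])
  then have "cc k (htpy (k - 1) (d k v)) y = (\<Sum>c\<in>I (k - 1). D k c v * P (k - 1, c) (k, y))"
    using vI finite_I by simp
  then show "cc k (path_sum C I M (k, v) k (I k)) y = cc k (contraction.incl k v) y"
    unfolding contraction.incl_def
    using critical_first_step[OF v, of "(k, y)"] y
    by (auto simp: path_sum_coord(2)[OF subset_refl] cc_add[OF vc hd] F.coord_basis[OF vI])
qed

text \<open>After the first step down from \<open>v\<close>, a path to a critical vertex of degree \<open>k - 1\<close> is one of those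
  that define \<open>proj\<close>.\<close>

lemma path_sum_bdry:
  assumes v: "v \<in> critical I M k"
  shows "path_sum C I M (k, v) (k - 1) (critical I M (k - 1)) = contraction.proj (k - 1) (d k v)"
proof (rule eq_coordsI)
  have vc: "v \<in> carrier (V k)" using v subsets_I(1) I_carrier by blast
  have dv: "d k v \<in> carrier (V (k - 1))" by (rule d_maps(1)[OF vc])
  show "path_sum C I M (k, v) (k - 1) (critical I M (k - 1)) \<in> carrier (V (k - 1))"
    by (rule path_sum_coord(1)[OF subsets_I(1)])
  show "contraction.proj (k - 1) (d k v) \<in> carrier (V (k - 1))"
    by (rule contraction.proj_maps(1)[OF dv])
  fix u assume "u \<in> I (k - 1)"
  have "cc (k - 1) (contraction.proj (k - 1) (d k v)) u =
      (\<Sum>c\<in>I (k - 1). D k c v * (if u \<in> critical I M (k - 1) then P (k - 1, c) (k - 1, u) else 0))"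
    unfolding coord_linear_I[OF contraction.proj_lin dv]
    by (rule sum.cong) (simp_all add: coord_proj bdry_entry_def)
  then show "cc (k - 1) (path_sum C I M (k, v) (k - 1) (critical I M (k - 1))) u =
      cc (k - 1) (contraction.proj (k - 1) (d k v)) u"
    using critical_first_step[OF v, of "(k - 1, u)"]
    by (simp add: path_sum_coord(2)[OF subsets_I(1)])
qed

lemma reduced_complex_retraction:
  shows "fd_chain_complex (reduced_complex C I M)"
    and "chain_retraction C (reduced_complex C I M) (reduction_f C I M) (reduction_g C I M)"
proof -
  note crit = F.free_subfamily[OF subsets_I(1)]
  have sp: "chain_space (reduced_complex C I M) k = (V k)\<lparr>carrier := V.span k (critical I M k)\<rparr>" for k
    by (simp add: reduced_complex_def)
  have b: "bdry (reduced_complex C I M) k x = contraction.proj (k - 1) (d k x)"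
    if x: "x \<in> V.span k (critical I M k)" for k x
  proof -
    have "linear_map class_ring (V k) (V (k - 1)) (\<lambda>x. contraction.proj (k - 1) (d k x))"
      by (rule linear_map_comp[OF fd_chain_complexD(3)[OF fd] contraction.proj_lin])
    from free_family.lin_ext_of_linear[OF crit this path_sum_bdry x]
    show ?thesis by (simp add: reduced_complex_def)
  qed
  have f: "reduction_f C I M k x = contraction.incl k x" if x: "x \<in> V.span k (critical I M k)" for k x
    unfolding reduction_f_def
    by (rule free_family.lin_ext_of_linear[OF crit contraction.incl_lin path_sum_incl x])
  have g: "reduction_g C I M k x = contraction.proj k x" if x: "x \<in> carrier (V k)" for k x
    unfolding reduction_g_def
    by (rule F.lin_ext_of_linear[OF contraction.proj_lin path_sum_critical]) (use x span_I in auto)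
  show "fd_chain_complex (reduced_complex C I M)"
    and "chain_retraction C (reduced_complex C I M) (reduction_f C I M) (reduction_g C I M)"
    using contraction.reduced_retraction[OF sp b f g] by auto
qed

lemma critical_basis:
  "vectorspace.basis class_ring (chain_space (reduced_complex C I M) k) (critical I M k)"
proof -
  have sub: "critical I M k \<subseteq> carrier (V k)" using subsets_I F.B_sub by blast
  have S: "submodule class_ring (V.span k (critical I M k)) (V k)" by (rule V.span_is_submodule[OF sub])
  have inS: "critical I M k \<subseteq> V.span k (critical I M k)" by (rule V.in_own_span[OF sub])
  interpret S: vectorspace class_ring "(V k)\<lparr>carrier := V.span k (critical I M k)\<rparr>"
    by (intro V.subspace_is_vs subspace.intro V.vectorspace_axioms S)
  have "S.basis (critical I M k)"
    unfolding S.basis_def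
    using V.span_li_not_depend[OF inS S] inS V.subset_li_is_li[OF F.indpt subsets_I(1)] by simp
  then show ?thesis by (simp add: reduced_complex_def)
qed

lemma critical_card_less:
  assumes "M \<noteq> {}"
  shows "card (SIGMA k:UNIV. critical I M k) < card (SIGMA k:UNIV. I k)"
proof (rule psubset_card_mono[OF finite_vertices], rule psubsetI)
  show "(SIGMA k:UNIV. critical I M k) \<subseteq> (SIGMA k:UNIV. I k)" using subsets_I(1) by blast
  obtain e where "e \<in> M" using assms by blast
  then obtain k v u where "matched k v u" by (rule M_cases)
  then have "v \<in> I k" "v \<in> sources k" using matchedD by (auto simp: sources_def)
  then have "v \<in> I k" "v \<notin> critical I M k" by (auto simp: critical_iff)
  then show "(SIGMA k:UNIV. critical I M k) \<noteq> (SIGMA k:UNIV. I k)" by blast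
qed

end

lemma reduction_step_retraction:
  assumes "fd_chain_complex C" "reduction_step C C' f g"
  shows "fd_chain_complex C'" "chain_retraction C C' f g"
proof -
  obtain I M where *: "\<forall>k. vectorspace.basis class_ring (chain_space C k) (I k)" "morse_matching C I M"
    "C' = reduced_complex C I M" "f = reduction_f C I M" "g = reduction_g C I M"
    using assms(2) unfolding reduction_step_def by blast
  interpret matched_complex C I M
    by (intro matched_complex.intro based_complex.intro matched_complex_axioms.intro) (use * assms(1) in auto)
  show "fd_chain_complex C'" "chain_retraction C C' f g"
    using reduced_complex_retraction * by auto
qed

lemma reductions_retraction:
  assumes "reductions C C' f g" "fd_chain_complex C"
  shows "fd_chain_complex C' \<and> chain_retraction C C' f g"
  using assms(1)
proof induction
  case refl
  then show ?case using assms(2) chain_retraction_id by blast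
next
  case (step C' f g C'' f' g')
  then show ?case
    using reduction_step_retraction[of C' C'' f' g'] chain_retraction_comp[OF assms(2)] by blast
qed

section \<open>Existence of complete reductions\<close>

lemma decreasing_no_cycle:
  fixes \<rho> :: "'a \<Rightarrow> int"
  assumes "\<And>a b. (a, b) \<in> parcs H \<Longrightarrow> \<rho> b < \<rho> a"
  shows "\<not> pre_digraph.cycle (with_proj H) p"
proof
  assume "pre_digraph.cycle (with_proj H) p"
  then obtain a where a: "pcas a p a" "set p \<subseteq> parcs H" "p \<noteq> []"
    by (auto simp: pre_digraph.cycle_def pre_digraph.awalk_def cas_with_proj_eq)
  have "\<rho> b + int (length p) \<le> \<rho> a" if "pcas a p b" "set p \<subseteq> parcs H" for a b
    using that
  proof (induction p arbitrary: a)
    case (Cons e es)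
    then have "\<rho> b + int (length es) \<le> \<rho> (snd e)" "\<rho> (snd e) < \<rho> a"
      using assms[of "fst e" "snd e"] by auto
    then show ?case by simp
  qed simp
  from this[OF a(1,2)] show False using a(3) by simp
qed

text \<open>The reversed edge is the only arc that gains a degree.  A cycle would have to return from \<open>(k, v)\<close>
  to \<open>(k - 1, u)\<close> in one step, along the edge that has been removed.\<close>

lemma (in based_complex) single_edge_matching:
  assumes v: "v \<in> I k" and u: "u \<in> I (k - 1)" and nz: "D k u v \<noteq> 0"
  shows "morse_matching C I {((k, v), (k - 1, u))}"
proof -
  let ?e = "((k, v), (k - 1, u))"
  \<comment> \<open>Along arcs the degrees decrease if \<open>k\<close> and \<open>k - 1\<close> are refined by placing first the other vectors
      of degree \<open>k\<close>, then \<open>u\<close>, then \<open>v\<close>, then the other vectors of degree \<open>k - 1\<close>; the factor 3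
      makes room for this.\<close>
  define \<rho> where "\<rho> a = (if a = (k - 1, u) then 3 * k - 1 else if a = (k, v) then 3 * k - 2 else 3 * fst a)" for a
  have "\<rho> b < \<rho> a" if ab: "(a, b) \<in> parcs (morse_graph C I {?e})" for a b
  proof (cases "(a, b) = ((k - 1, u), (k, v))")
    case True
    then show ?thesis by (simp add: \<rho>_def)
  next
    case False
    then obtain l x y where "a = (l, x)" "b = (l - 1, y)" "(a, b) \<noteq> ?e"
      using ab by (auto simp: morse_graph_def complex_graph_def)
    then show ?thesis unfolding \<rho>_def by (cases "a = (k, v)"; cases "b = (k - 1, u)"; auto)
  qed
  then have "\<not> pre_digraph.cycle (with_proj (morse_graph C I {?e})) p" for p
    by (rule decreasing_no_cycle)
  then show ?thesis
    using assms unfolding morse_matching_def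
    by (simp add: complex_graph_def edge_weight_def dvd_field_iff)
qed

lemma (in based_complex) nonzero_entry:
  assumes "\<not> zero_boundaries C"
  obtains k u v where "v \<in> I k" "u \<in> I (k - 1)" "D k u v \<noteq> 0"
proof (rule ccontr)
  assume "\<not> thesis"
  then have no: "D k u v = 0" if "v \<in> I k" "u \<in> I (k - 1)" for k u v
    using \<open>\<And>k v u. v \<in> I k \<Longrightarrow> u \<in> I (k - 1) \<Longrightarrow> D k u v \<noteq> 0 \<Longrightarrow> thesis\<close> that by blast
  have "d k x = \<zero>\<^bsub>V (k - 1)\<^esub>" if x: "x \<in> carrier (V k)" for k x
  proof (rule eq_coordsI)
    fix u assume "u \<in> I (k - 1)"
    then have "cc k x v * D k u v = 0" if "v \<in> I k" for v
      using no[OF that] by simp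
    then show "cc (k - 1) (d k x) u = cc (k - 1) \<zero>\<^bsub>V (k - 1)\<^esub> u"
      by (simp add: coord_bdry[OF x] F.coord_zero)
  qed (use d_maps(1)[OF x] in auto)
  then show False using assms by (simp add: zero_boundaries_def)
qed

lemma reductions_prepend:
  assumes "reductions C1 C' f g" "reduction_step C C1 f1 g1"
  shows "reductions C C' (f1 \<circ>\<^sub>g f) (g \<circ>\<^sub>g g1)"
  using assms(1)
proof induction
  case refl
  have "f1 \<circ>\<^sub>g graded_id = graded_id \<circ>\<^sub>g f1" "graded_id \<circ>\<^sub>g g1 = g1 \<circ>\<^sub>g graded_id"
    by (simp_all add: graded_comp_def graded_id_def)
  then show ?case using reductions.step[OF reductions.refl assms(2)] by simp
next
  case (step C' f g C'' f' g')
  have "f1 \<circ>\<^sub>g (f \<circ>\<^sub>g f') = (f1 \<circ>\<^sub>g f) \<circ>\<^sub>g f'" "(g' \<circ>\<^sub>g g) \<circ>\<^sub>g g1 = g' \<circ>\<^sub>g (g \<circ>\<^sub>g g1)"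
    by (simp_all add: graded_comp_def comp_assoc)
  then show ?case using reductions.step[OF step.IH step.hyps(2)] by simp
qed

text \<open>The critical vectors form a basis of the reduced complex, and a nonempty matching leaves fewer of them
  than there were vertices.\<close>

lemma complete_reduction_exists:
  fixes C :: "('k::field, 'v) chain_complex"
  assumes "fd_chain_complex C" "\<And>k. vectorspace.basis class_ring (chain_space C k) (I k)"
  shows "\<exists>C' f g. complete_reduction C C' f g"
  using assms
proof (induction "card (SIGMA k:UNIV. I k)" arbitrary: C I rule: less_induct)
  case less
  interpret based_complex C I by (rule based_complex.intro) (use less.prems in auto)
  show ?case
  proof (cases "zero_boundaries C")
    case True
    then show ?thesis using reductions.refl unfolding complete_reduction_def by blast
  next
    case False
    then obtain k u v where "v \<in> I k" "u \<in> I (k - 1)" "D k u v \<noteq> 0" by (rule nonzero_entry)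
    then have M: "morse_matching C I {((k, v), (k - 1, u))}" (is "morse_matching C I ?M")
      by (rule single_edge_matching)
    interpret matched_complex C I ?M by unfold_locales (rule M)
    let ?C = "reduced_complex C I ?M"
    have "reduction_step C ?C (reduction_f C I ?M) (reduction_g C I ?M)"
      unfolding reduction_step_def using bases M by blast
    moreover obtain C' f g where "complete_reduction ?C C' f g"
      using less.hyps[OF critical_card_less reduced_complex_retraction(1) critical_basis] by auto
    ultimately show ?thesis
      unfolding complete_reduction_def using reductions_prepend by blast
  qed
qed

theorem lemma1p5:
  shows "(\<forall>C :: ('k::field, 'v) chain_complex. fd_chain_complex C \<longrightarrow>
            (\<exists>C' f g. complete_reduction C C' f g)) \<and>
         (\<forall>(R :: ('k, 'v) chain_complex \<Rightarrow> ('k, 'v) chain_complex)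
           (f :: ('k, 'v) chain_complex \<Rightarrow> int \<Rightarrow> 'v \<Rightarrow> 'v)
           (g :: ('k, 'v) chain_complex \<Rightarrow> int \<Rightarrow> 'v \<Rightarrow> 'v).
            (\<forall>C. fd_chain_complex C \<longrightarrow> complete_reduction C (R C) (f C) (g C)) \<longrightarrow>
            graded_functor (\<lambda>C. chain_space (R C)) (\<lambda>C D \<phi>. g D \<circ>\<^sub>g \<phi> \<circ>\<^sub>g f C) \<and>
            graded_functor homology homology_map \<and>
            naturally_isomorphic (\<lambda>C. chain_space (R C)) (\<lambda>C D \<phi>. g D \<circ>\<^sub>g \<phi> \<circ>\<^sub>g f C)
              homology homology_map)"
proof (intro conjI allI impI)
  fix C :: "('k, 'v) chain_complex"
  assume C: "fd_chain_complex C"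
  have "\<exists>B. vectorspace.basis class_ring (chain_space C k) B" for k
    using vectorspace.finite_basis_exists[OF fd_chain_complexD(1,2)[OF C]] by blast
  then obtain I where "\<And>k. vectorspace.basis class_ring (chain_space C k) (I k)" by metis
  then show "\<exists>C' f g. complete_reduction C C' f g"
    by (rule complete_reduction_exists[OF C])
next
  fix R :: "('k, 'v) chain_complex \<Rightarrow> ('k, 'v) chain_complex"
    and f g :: "('k, 'v) chain_complex \<Rightarrow> int \<Rightarrow> 'v \<Rightarrow> 'v"
  assume *: "\<forall>C. fd_chain_complex C \<longrightarrow> complete_reduction C (R C) (f C) (g C)"
  have R: "fd_chain_complex (R C)" "zero_boundaries (R C)" "chain_retraction C (R C) (f C) (g C)"
    if "fd_chain_complex C" for C
    using * that reductions_retraction[of C "R C" "f C" "g C"] unfolding complete_reduction_def by auto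
  show "graded_functor (\<lambda>C. chain_space (R C)) (\<lambda>C D \<phi>. g D \<circ>\<^sub>g \<phi> \<circ>\<^sub>g f C)"
    by (rule retract_graded_functor[OF R])
  show "naturally_isomorphic (\<lambda>C. chain_space (R C)) (\<lambda>C D \<phi>. g D \<circ>\<^sub>g \<phi> \<circ>\<^sub>g f C)
      homology homology_map"
    by (rule retract_naturally_isomorphic_homology[OF R])
qed (rule homology_graded_functor)

end
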